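(* Let $n\in\mathbb N$, $n\ge 1$, and let $\alpha,\beta,h_1,\dots,h_{n-1}>0$. Let $(\theta,\varphi)$ be the TASEP random dynamical system with $n$ sites, entry rate $\alpha$, exit rate $\beta$ and internal rates $h_1,\dots,h_{n-1}$, on the state space $X=\{0,1\}^n$ over the probability space $(\Omega,\mathcal F,\mathbb P)$. For $t\geq 0$ and $t_0\in\mathbb R$ let $$\Gamma(t,t_0):=\{\omega\in\Omega:\varphi(t,x_1,\theta_{t_0}\omega)=\varphi(t,x_2,\theta_{t_0}\omega)\text{ for all }x_1,x_2\in X\}.$$ Then for any $t>0$ there exists $\delta>0$ such that $\mathbb P(\Gamma(t,0))\ge\delta$.
   Context: TASEP random dynamical system. Single hop: for $x=(s_1,\dots,s_n)\in X=\{0,1\}^n$ and $k\in\{0,\dots,n\}$ let $f(x,0)=(1,s_2,\dots,s_n)$; $f(x,n)=(s_1,\dots,s_{n-1},0)$; for $1\le k\le n-1$ with $s_k=1$ and $s_{k+1}=0$ let $f(x,k)=(s_1,\dots,s_{k-1},0,1,s_{k+2},\dots,s_n)$; and $f(x,k)=x$ otherwise. Clock space: for $\lambda>0$ let $\mathcal W^\lambda=(\hat\Omega,\hat{\mathcal F},\mathbb P^\lambda)$ be the space of sequences $(\xi_i)_{i\in\mathbb Z}$ with $\xi_0\ge 0$, $\xi_i>0$ for $i\ne 0$, and $\sum_{i\ge 0}\xi_i=\sum_{i\ge 1}\xi_{-i}=\infty$, with the (trace of the) product $\sigma$-algebra and the product measure under which the $\xi_i$ are i.i.d. exponential with rate $\lambda$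 (the divergence conditions remove a null set). Define $\Phi((\xi_i)_i)=(Y_l)_{l\in\mathbb Z}$ by $Y_l=\sum_{i=0}^l\xi_i$ for $l\ge 0$ and $Y_l=-\sum_{i=1}^{-l}\xi_{-i}$ for $l<0$. $\Phi$ is a bijection from $\hat\Omega$ onto the strictly increasing sequences $(a_l)_{l\in\mathbb Z}$ with $a_{-1}<0\le a_0$ and $a_l\to\pm\infty$ as $l\to\pm\infty$; $\{Y_l\}$ is a homogeneous Poisson process on $\mathbb R$ with rate $\lambda$. For $t\in\mathbb R$ let $\hat\theta_t(\hat\omega)=\Phi^{-1}((b_l)_l)$, where $b_l=Y_{l+l_0}-t$ and $l_0$ is the unique integer with $Y_{l_0-1}-t<0\le Y_{l_0}-t$ (shift of the point configuration by $-t$). Probability space: put $h_0:=\alpha$, $h_n:=\beta$. $(\Omega,\mathcal F,\mathbb P)$ is the product $\mathcal W^{h_0}\times\mathcal W^{h_1}\times\cdots\times\mathcal W^{h_n}$ restricted to the full-measure event that all jump times $T_{k,j}(\omega):=\Phi(\omega_k)_j$ ($0\le k\le n$, $j\in\mathbb Z$) for different $k$ are distinct. Set $\theta_t(\omega_0,\dots,\omega_n)=(\hat\theta_t(\omega_0),\dots,\hat\theta_t(\omega_n))$. List all jump times in increasing order as $(t_i(\omega))_{i\in\mathbb Z}$ with $t_{-1}<0\le t_0$, and let $k_i(\omega)\in\{0,\dots,n\}$ be the index with $t_i(\omega)=T_{k_i,j}(\omega)$ for some $j$. Cocycle: for $t\ge 0$, $\varphi(t,x,\omega)=x$ if no $t_i(\omega)$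 lies in $[0,t)$; otherwise, if $t_0(\omega)<\dots<t_m(\omega)$ are all the jump times in $[0,t)$, set $x_0=x$, $x_{p+1}=f(x_p,k_p(\omega))$ for $p=0,\dots,m$, and $\varphi(t,x,\omega)=x_{m+1}$. *)

theory Defs
  imports "HOL-Probability.Probability"
begin

text \<open>
  Configurations, with sites numbered from 1 to n.  They are taken in the extensional function
  space, so that equality of functions is equality of configurations.
\<close>

definition states :: "nat \<Rightarrow> (nat \<Rightarrow> nat) set" where
  "states n = (\<Pi>\<^sub>E i\<in>{1..n}. {0, 1})"

definition hop :: "nat \<Rightarrow> (nat \<Rightarrow> nat) \<Rightarrow> nat \<Rightarrow> (nat \<Rightarrow> nat)" where
  "hop n x k =
     (if k = 0 then x(1 := 1)
      else if k = n then x(n := 0)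
      else if 1 \<le> k \<and> k \<le> n - 1 \<and> x k = 1 \<and> x (k + 1) = 0 then x(k := 0, k + 1 := 1)
      else x)"

text \<open>
  Sequences of waiting times: entry 0 is the time from the origin to the first arrival at or after
  it, entries of positive index lead forward from there and entries of negative index backward
  from the origin.  Only finitely many arrivals occur in a bounded time, in both directions.
\<close>

definition clock_paths :: "(int \<Rightarrow> real) set" where
  "clock_paths = {\<xi>. \<xi> 0 \<ge> 0 \<and> (\<forall>i. i \<noteq> 0 \<longrightarrow> \<xi> i > 0)
     \<and> (\<Sum>i::nat. ennreal (\<xi> (int i))) = \<infinity>
     \<and> (\<Sum>i::nat. ennreal (\<xi> (- int (Suc i)))) = \<infinity>}"

definition clock_space :: "real \<Rightarrow> (int \<Rightarrow> real) measure" where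
  "clock_space l =
     restrict_space
       (\<Pi>\<^sub>M i\<in>UNIV. density lborel (\<lambda>x. ennreal (exponential_density l x)))
       clock_paths"

definition arrivals :: "(int \<Rightarrow> real) \<Rightarrow> (int \<Rightarrow> real)" where
  "arrivals \<xi> = (\<lambda>l. if l \<ge> 0 then (\<Sum>i=0..l. \<xi> i) else - (\<Sum>i=1..-l. \<xi> (- i)))"

definition clock_shift :: "real \<Rightarrow> (int \<Rightarrow> real) \<Rightarrow> (int \<Rightarrow> real)" where
  "clock_shift t \<xi> =
     (let Y = arrivals \<xi>;
          l0 = (THE l. Y (l - 1) - t < 0 \<and> 0 \<le> Y l - t)
      in inv_into clock_paths arrivals (\<lambda>l. Y (l + l0) - t))"

definition rate :: "nat \<Rightarrow> real \<Rightarrow> real \<Rightarrow> (nat \<Rightarrow> real) \<Rightarrow> nat \<Rightarrow> real" where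
  "rate n \<alpha> \<beta> h k = (if k = 0 then \<alpha> else if k = n then \<beta> else h k)"

definition jump_time :: "(nat \<Rightarrow> int \<Rightarrow> real) \<Rightarrow> nat \<Rightarrow> int \<Rightarrow> real" where
  "jump_time \<omega> k j = arrivals (\<omega> k) j"

definition tasep_space ::
  "nat \<Rightarrow> real \<Rightarrow> real \<Rightarrow> (nat \<Rightarrow> real) \<Rightarrow> (nat \<Rightarrow> int \<Rightarrow> real) measure" where
  "tasep_space n \<alpha> \<beta> h =
     restrict_space (\<Pi>\<^sub>M k\<in>{0..n}. clock_space (rate n \<alpha> \<beta> h k))
       {\<omega>. \<forall>k\<in>{0..n}. \<forall>k'\<in>{0..n}. \<forall>j j'. k \<noteq> k' \<longrightarrow> jump_time \<omega> k j \<noteq> jump_time \<omega> k' j'}"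

definition tasep_shift :: "nat \<Rightarrow> real \<Rightarrow> (nat \<Rightarrow> int \<Rightarrow> real) \<Rightarrow> (nat \<Rightarrow> int \<Rightarrow> real)" where
  "tasep_shift n t \<omega> = (\<lambda>k\<in>{0..n}. clock_shift t (\<omega> k))"

text \<open>
  On the sample space the jump times are pairwise distinct between clocks, locally finite and
  unbounded in both directions, so the definite descriptions below denote.
\<close>

definition ordered_times :: "nat \<Rightarrow> (nat \<Rightarrow> int \<Rightarrow> real) \<Rightarrow> (int \<Rightarrow> real)" where
  "ordered_times n \<omega> =
     (THE \<tau>. strict_mono \<tau> \<and> range \<tau> = {jump_time \<omega> k j | k j. k \<in> {0..n}}
        \<and> \<tau> (-1) < 0 \<and> 0 \<le> \<tau> 0)"

definition jump_index :: "nat \<Rightarrow> (nat \<Rightarrow> int \<Rightarrow> real) \<Rightarrow> int \<Rightarrow> nat" where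
  "jump_index n \<omega> i =
     (THE k. k \<in> {0..n} \<and> (\<exists>j. ordered_times n \<omega> i = jump_time \<omega> k j))"

primrec after_jumps ::
  "nat \<Rightarrow> (nat \<Rightarrow> nat) \<Rightarrow> (nat \<Rightarrow> int \<Rightarrow> real) \<Rightarrow> nat \<Rightarrow> (nat \<Rightarrow> nat)" where
  "after_jumps n x \<omega> 0 = x"
| "after_jumps n x \<omega> (Suc p) = hop n (after_jumps n x \<omega> p) (jump_index n \<omega> (int p))"

definition cocycle ::
  "nat \<Rightarrow> real \<Rightarrow> (nat \<Rightarrow> nat) \<Rightarrow> (nat \<Rightarrow> int \<Rightarrow> real) \<Rightarrow> (nat \<Rightarrow> nat)" where
  "cocycle n t x \<omega> =
     (let I = {i. ordered_times n \<omega> i \<in> {0..<t}}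
      in if I = {} then x else after_jumps n x \<omega> (Suc (THE m. I = {0..int m})))"

definition sync_event ::
  "nat \<Rightarrow> real \<Rightarrow> real \<Rightarrow> (nat \<Rightarrow> real) \<Rightarrow> real \<Rightarrow> real \<Rightarrow> (nat \<Rightarrow> int \<Rightarrow> real) set" where
  "sync_event n \<alpha> \<beta> h t t0 =
     {\<omega> \<in> space (tasep_space n \<alpha> \<beta> h).
        \<forall>x1\<in>states n. \<forall>x2\<in>states n.
          cocycle n t x1 (tasep_shift n t0 \<omega>) = cocycle n t x2 (tasep_shift n t0 \<omega>)}"

end

theory Submission
  imports Defs
begin

text \<open>
  Up to time \<open>t\<close> the cocycle depends on \<open>\<omega>\<close> only through the finite list of jumps in \<open>[0, t)\<close>, in
  order of time.  Each such list is described by countably many inequalities between jump times, so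
  the synchronisation event is measurable as a countable union over the lists that send all initial
  configurations to the same one.  One such list rings the clocks \<open>n, n - 1, \<dots>, 1\<close> in this order
  \<open>n\<close> times: every sweep moves all particles one site to the right, so in the end the system is
  empty.  This list is realised as soon as finitely many waiting times lie in suitable open
  intervals, which by independence has positive probability.
\<close>

section \<open>Arrivals of one clock and enumeration of locally finite sets\<close>

text \<open>\<open>cocycle\<close> reaches the jumps only through definite descriptions, so nothing
  can be computed before the enumeration of the jump times by the integers is known to exist and to
  be unique. Measurability of the event is no formality: \<open>emeasure\<close> is 0 on
  non-measurable sets, so a bound from below by a smaller event would fail without it. A list is
  realised only if it contains all jumps in [0, t). Hence clock 0 has to stay silent, as an entry
  would put a particle behind the vacancies, and every other clock has to ring exactly n times. One
  sweep creates just one vacancy, at site 1; n sweeps are taken so that the vacancies fill all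
  sites. Each ring gets a time slot of length d = t / n^2, because n sweeps of n rings are to fill
  [0, t).\<close>

lemma arrivals_int: "arrivals \<xi> (int m) = (\<Sum>i\<le>m. \<xi> (int i))"
proof -
  have "{0..int m} = int ` {..m}"
    by (metis atLeast0AtMost image_int_atLeastAtMost of_nat_0)
  then show ?thesis
    by (simp add: arrivals_def sum.reindex)
qed

lemma arrivals_neg: "arrivals \<xi> (- int (Suc m)) = - (\<Sum>i\<le>m. \<xi> (- int (Suc i)))"
proof -
  have "{1..int (Suc m)} = (\<lambda>i. int (Suc i)) ` {..m}"
    by (metis image_Suc_atMost image_image image_int_atLeastAtMost of_nat_1)
  moreover have "inj_on (\<lambda>i. int (Suc i)) {..m}"
    by (auto simp: inj_on_def)
  ultimately have "(\<Sum>i=1..int (Suc m). \<xi> (- i)) = (\<Sum>i\<le>m. \<xi> (- int (Suc i)))"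
    by (simp only: sum.reindex o_def)
  then show ?thesis
    by (simp add: arrivals_def add.commute)
qed

lemma arrivals_0: "arrivals \<xi> 0 = \<xi> 0"
  using arrivals_int[of \<xi> 0] by simp

lemma arrivals_minus_1: "arrivals \<xi> (-1) = - \<xi> (-1)"
  using arrivals_neg[of \<xi> 0] by simp

lemma int_nonneg_neg_cases:
  obtains m where "l = int m" | m where "l = - int (Suc m)"
  by (metis int_cases)

lemma arrivals_step_nonneg: "l \<ge> 0 \<Longrightarrow> arrivals \<xi> (l + 1) = arrivals \<xi> l + \<xi> (l + 1)"
proof -
  assume "l \<ge> 0"
  then obtain m where "l = int m"
    using nonneg_int_cases by blast
  then show ?thesis
    using arrivals_int[of \<xi> "Suc m"] arrivals_int[of \<xi> m] by (simp add: add.commute)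
qed

text \<open>Backward entries are indexed by the left end of the gap that they measure, forward
  entries by the right end. The gap from arrival -1 to arrival 0 contains the origin and is split
  into \<open>\<xi> (-1)\<close> and \<open>\<xi> 0\<close>, so arguments by steps treat it
  separately.\<close>

lemma arrivals_step_neg: "l < -1 \<Longrightarrow> arrivals \<xi> (l + 1) = arrivals \<xi> l + \<xi> l"
proof -
  assume "l < -1"
  then have "l = - int (Suc (Suc (nat (- l - 2))))"
    by simp
  then obtain m where "l = - int (Suc (Suc m))" ..
  then show ?thesis
    using arrivals_neg[of \<xi> "Suc m"] arrivals_neg[of \<xi> m] by simp
qed

text \<open>Differences of consecutive arrivals return the entries, except that entries 0 and -1 are
  read off from the arrivals with these numbers. This makes \<open>inv_into\<close> in
  \<open>clock_shift\<close> a genuine inverse.\<close>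

lemma inj_arrivals: "inj arrivals"
proof (rule injI, rule ext)
  fix \<xi> \<zeta> :: "int \<Rightarrow> real" and l :: int
  assume eq: "arrivals \<xi> = arrivals \<zeta>"
  consider "l = 0" | "l \<ge> 1" | "l = -1" | "l < -1"
    by linarith
  then show "\<xi> l = \<zeta> l"
  proof cases
    case 1
    then show ?thesis using arrivals_0[of \<xi>] arrivals_0[of \<zeta>] eq by simp
  next
    case 2
    then show ?thesis
      using arrivals_step_nonneg[of "l - 1" \<xi>] arrivals_step_nonneg[of "l - 1" \<zeta>] eq by simp
  next
    case 3
    then show ?thesis using arrivals_minus_1[of \<xi>] arrivals_minus_1[of \<zeta>] eq by simp
  next
    case 4
    then show ?thesis
      using arrivals_step_neg[of l \<xi>] arrivals_step_neg[of l \<zeta>] eq by simp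
  qed
qed

lemma strict_mono_int_stepI:
  fixes f :: "int \<Rightarrow> real"
  assumes "\<And>l. f l < f (l + 1)"
  shows "strict_mono f"
proof (rule strict_monoI)
  fix l l' :: int
  assume "l < l'"
  then show "f l < f l'"
  proof (induction rule: int_gr_induct)
    case base
    then show ?case by (rule assms)
  next
    case (step i)
    then show ?case using assms[of i] by simp
  qed
qed

lemma strict_mono_arrivals:
  assumes "\<xi> \<in> clock_paths"
  shows "strict_mono (arrivals \<xi>)"
proof (rule strict_mono_int_stepI)
  fix l :: int
  have pos: "\<And>i. i \<noteq> 0 \<Longrightarrow> \<xi> i > 0" "\<xi> 0 \<ge> 0"
    using assms by (auto simp: clock_paths_def)
  consider "l \<ge> 0" | "l = -1" | "l < -1"
    by linarith
  then show "arrivals \<xi> l < arrivals \<xi> (l + 1)"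
  proof cases
    case 1
    then show ?thesis using arrivals_step_nonneg[of l \<xi>] pos(1)[of "l + 1"] by simp
  next
    case 2
    then show ?thesis
      using arrivals_0[of \<xi>] arrivals_minus_1[of \<xi>] pos(1)[of "-1"] pos(2) by simp
  next
    case 3
    then show ?thesis using arrivals_step_neg[of l \<xi>] pos(1)[of l] by simp
  qed
qed

lemma arrivals_at_origin:
  assumes "\<xi> \<in> clock_paths"
  shows "arrivals \<xi> (-1) < 0" "0 \<le> arrivals \<xi> 0"
  using assms by (auto simp: arrivals_0 arrivals_minus_1 clock_paths_def)

lemma sum_unbounded_of_ennreal_suminf:
  fixes f :: "nat \<Rightarrow> real"
  assumes nonneg: "\<And>i. f i \<ge> 0" and inf: "(\<Sum>i. ennreal (f i)) = \<infinity>"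
  shows "\<exists>m. c < (\<Sum>i\<le>m. f i)"
proof (rule ccontr)
  assume "\<not> ?thesis"
  then have le: "(\<Sum>i\<le>m. f i) \<le> c" for m
    by (auto simp: not_less)
  have "(\<Sum>i<m. ennreal (f i)) \<le> ennreal c" for m
  proof -
    have "(\<Sum>i<m. f i) \<le> (\<Sum>i\<le>m. f i)"
      by (intro sum_mono2) (auto simp: nonneg)
    then have "ennreal (\<Sum>i<m. f i) \<le> ennreal c"
      using le[of m] by (intro ennreal_leI) linarith
    then show ?thesis
      by (simp add: sum_ennreal nonneg)
  qed
  then have "(\<Sum>i. ennreal (f i)) \<le> ennreal c"
    by (intro suminf_le_const) auto
  with inf show False
    by (simp add: top_unique)
qed

lemma arrivals_unbounded_above:
  assumes "\<xi> \<in> clock_paths"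
  shows "\<exists>l. c < arrivals \<xi> l"
proof -
  have "\<exists>m. c < (\<Sum>i\<le>m. \<xi> (int i))"
  proof (rule sum_unbounded_of_ennreal_suminf)
    show "0 \<le> \<xi> (int i)" for i
      using assms by (cases "i = 0") (auto simp: clock_paths_def intro: less_imp_le)
  qed (use assms in \<open>simp add: clock_paths_def\<close>)
  then show ?thesis
    by (metis arrivals_int)
qed

lemma arrivals_unbounded_below:
  assumes "\<xi> \<in> clock_paths"
  shows "\<exists>l. arrivals \<xi> l < c"
proof -
  have "\<exists>m. - c < (\<Sum>i\<le>m. \<xi> (- int (Suc i)))"
  proof (rule sum_unbounded_of_ennreal_suminf)
    show "0 \<le> \<xi> (- int (Suc i))" for i
      using assms by (auto simp: clock_paths_def intro!: less_imp_le)
  qed (use assms in \<open>simp add: clock_paths_def\<close>)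
  then obtain m where "- c < (\<Sum>i\<le>m. \<xi> (- int (Suc i)))" ..
  then have "arrivals \<xi> (- int (Suc m)) < c"
    unfolding arrivals_neg by linarith
  then show ?thesis ..
qed

lemma finite_arrivals_between:
  assumes "\<xi> \<in> clock_paths"
  shows "finite {l. arrivals \<xi> l \<in> {a..b}}"
proof -
  obtain l1 l2 where "arrivals \<xi> l1 < a" "b < arrivals \<xi> l2"
    using arrivals_unbounded_below[OF assms] arrivals_unbounded_above[OF assms] by metis
  then have "{l. arrivals \<xi> l \<in> {a..b}} \<subseteq> {l1..l2}"
    using strict_mono_less[OF strict_mono_arrivals[OF assms]]
    by (smt (verit) atLeastAtMost_iff mem_Collect_eq subsetI)
  then show ?thesis
    by (rule finite_subset) simp
qed

text \<open>The origin lies between arrivals -1 and 0, so strict monotonicity leaves 0 as the only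
  possible relabelling index. The event concerns the shift by 0, which may therefore be
  dropped.\<close>

lemma clock_shift_0:
  assumes "\<xi> \<in> clock_paths"
  shows "clock_shift 0 \<xi> = \<xi>"
proof -
  have "(THE l. arrivals \<xi> (l - 1) - 0 < 0 \<and> 0 \<le> arrivals \<xi> l - 0) = 0"
  proof (rule the_equality)
    fix l
    assume *: "arrivals \<xi> (l - 1) - 0 < 0 \<and> 0 \<le> arrivals \<xi> l - 0"
    then have "arrivals \<xi> (l - 1) < arrivals \<xi> 0" "arrivals \<xi> (-1) < arrivals \<xi> l"
      using arrivals_at_origin[OF assms] by linarith+
    then show "l = 0"
      using strict_mono_less[OF strict_mono_arrivals[OF assms]] by fastforce
  qed (use arrivals_at_origin[OF assms] in simp)
  then have "clock_shift 0 \<xi> = inv_into clock_paths arrivals (arrivals \<xi>)"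
    by (simp add: clock_shift_def)
  also have "\<dots> = \<xi>"
    using inv_into_f_f[OF inj_on_subset[OF inj_arrivals subset_UNIV] assms] .
  finally show ?thesis .
qed

section \<open>Increasing enumerations of locally finite sets of reals\<close>

lemma nat_enumeration_of_locally_finite:
  fixes S :: "real set"
  assumes fin: "\<And>b. finite (S \<inter> {..b})" and unb: "\<And>c. \<exists>s\<in>S. c < s"
  shows "\<exists>\<sigma>::nat \<Rightarrow> real. strict_mono \<sigma> \<and> range \<sigma> = S"
proof -
  \<comment> \<open>A successor in S exists because only finitely many elements compete with any
    given element above c. The enumeration iterates this successor map.\<close>
  have "\<exists>s\<in>S. c < s \<and> (\<forall>s'\<in>S. c < s' \<longrightarrow> s \<le> s')" for c
  proof -
    obtain s0 where s0: "s0 \<in> S" "c < s0"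
      using unb by blast
    let ?F = "S \<inter> {..s0} \<inter> {c<..}"
    have F: "finite ?F" "?F \<noteq> {}"
      using fin[of s0] s0 by auto
    have "Min ?F \<in> ?F"
      using F by (rule Min_in)
    moreover have "Min ?F \<le> s'" if "s' \<in> S" "c < s'" for s'
      using that Min_le[OF F(1), of s'] Min_le[OF F(1), of s0] s0 by (cases "s' \<le> s0") auto
    ultimately show ?thesis by blast
  qed
  then obtain nxt where nxt: "\<And>c. nxt c \<in> S" "\<And>c. c < nxt c" "\<And>c s. s \<in> S \<Longrightarrow> c < s \<Longrightarrow> nxt c \<le> s"
    by metis
  \<comment> \<open>A starting point strictly below all of S, so that its successor is the least
    element of S.\<close>
  obtain c0 where c0: "\<And>s. s \<in> S \<Longrightarrow> c0 < s"
  proof (cases "S \<inter> {..0} = {}")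
    case True
    then show ?thesis using that[of 0] by force
  next
    case False
    show ?thesis
    proof (rule that[of "Min (S \<inter> {..0}) - 1"])
      fix s assume "s \<in> S"
      then show "Min (S \<inter> {..0}) - 1 < s"
        using Min_le[OF fin[of 0], of s] Min_in[OF fin[of 0] False] by (cases "s \<le> 0") auto
    qed
  qed
  define \<sigma> where "\<sigma> = rec_nat (nxt c0) (\<lambda>_. nxt)"
  have \<sigma>: "\<sigma> 0 = nxt c0" "\<sigma> (Suc m) = nxt (\<sigma> m)" for m
    by (auto simp: \<sigma>_def)
  have mono: "strict_mono \<sigma>"
    by (simp add: strict_mono_Suc_iff \<sigma> nxt)
  have sub: "\<sigma> m \<in> S" for m
    by (cases m) (auto simp: \<sigma> nxt)
  \<comment> \<open>An element that is missed would stay above every iterate, and infinitely many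
    elements of S would lie below it.\<close>
  have "s \<in> range \<sigma>" if s: "s \<in> S" for s
  proof (rule ccontr)
    assume no: "s \<notin> range \<sigma>"
    have "\<sigma> m < s" for m
    proof (induction m)
      case 0
      then show ?case using nxt(3)[OF s c0[OF s]] no \<sigma>(1) by (metis order_le_less rangeI)
    next
      case (Suc m)
      then show ?case using nxt(3)[OF s Suc] no \<sigma>(2) by (metis order_le_less rangeI)
    qed
    then have "range \<sigma> \<subseteq> S \<inter> {..s}"
      using sub by (auto intro: less_imp_le)
    then have "finite (range \<sigma>)"
      by (rule finite_subset) (rule fin)
    then show False
      using mono finite_imageD strict_mono_imp_inj_on infinite_UNIV_nat by blast
  qed
  with sub mono show ?thesis by blast
qed

text \<open>Existence glues enumerations of the nonnegative part and of the reflected negative part.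
  For uniqueness, two enumerations differ by an order automorphism of the integers; this is a
  translation, and the condition at the origin makes it trivial.\<close>

lemma ex1_int_enumeration:
  fixes S :: "real set"
  assumes fin: "\<And>a b. finite (S \<inter> {a..b})"
    and above: "\<And>c. \<exists>s\<in>S. c < s" and below: "\<And>c. \<exists>s\<in>S. s < c"
  shows "\<exists>!\<tau>::int \<Rightarrow> real. strict_mono \<tau> \<and> range \<tau> = S \<and> \<tau> (-1) < 0 \<and> 0 \<le> \<tau> 0"
proof -
  have "\<exists>\<sigma>::nat \<Rightarrow> real. strict_mono \<sigma> \<and> range \<sigma> = S \<inter> {0..}"
  proof (rule nat_enumeration_of_locally_finite)
    show "finite (S \<inter> {0..} \<inter> {..b})" for b
      by (rule finite_subset[OF _ fin[of 0 b]]) auto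
    show "\<exists>s\<in>S \<inter> {0..}. c < s" for c
      using above[of "max c 0"] by auto
  qed
  then obtain \<sigma> :: "nat \<Rightarrow> real" where \<sigma>: "strict_mono \<sigma>" "range \<sigma> = S \<inter> {0..}"
    by blast
  have "\<exists>\<sigma>::nat \<Rightarrow> real. strict_mono \<sigma> \<and> range \<sigma> = uminus ` (S \<inter> {..<0})"
  proof (rule nat_enumeration_of_locally_finite)
    show "finite (uminus ` (S \<inter> {..<0}) \<inter> {..b})" for b
    proof -
      have "uminus ` (S \<inter> {..<0}) \<inter> {..b} \<subseteq> uminus ` (S \<inter> {- b..0})"
        by force
      then show ?thesis
        by (rule finite_subset) (rule finite_imageI[OF fin])
    qed
    show "\<exists>s\<in>uminus ` (S \<inter> {..<0}). c < s" for c
    proof -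
      obtain s where "s \<in> S" "s < min (- c) 0"
        using below by blast
      then show ?thesis by (intro bexI[of _ "- s"]) auto
    qed
  qed
  then obtain \<rho> :: "nat \<Rightarrow> real" where \<rho>: "strict_mono \<rho>" "range \<rho> = uminus ` (S \<inter> {..<0})"
    by blast
  have \<sigma>_ge: "\<sigma> m \<ge> 0" for m
    using \<sigma>(2) by auto
  have \<rho>_pos: "\<rho> m > 0" for m
    using \<rho>(2) rangeI[of \<rho> m] by auto
  \<comment> \<open>The offset in \<open>- i - 1\<close> makes index -1 the negative element closest
    to the origin, which is \<open>- \<rho> 0\<close>.\<close>
  define \<tau> where "\<tau> = (\<lambda>i. if i \<ge> 0 then \<sigma> (nat i) else - \<rho> (nat (- i - 1)))"
  have \<tau>_int: "\<tau> (int m) = \<sigma> m" and \<tau>_neg: "\<tau> (- int (Suc m)) = - \<rho> m" for m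
    by (auto simp: \<tau>_def)
  have "strict_mono \<tau>"
  proof (rule strict_monoI)
    fix i j :: int
    assume "i < j"
    then show "\<tau> i < \<tau> j"
      using \<sigma>_ge[of "nat j"] \<rho>_pos[of "nat (- i - 1)"]
      by (auto simp: \<tau>_def strict_mono_less[OF \<sigma>(1)] strict_mono_less[OF \<rho>(1)])
  qed
  moreover have "range \<tau> = S"
  proof
    show "range \<tau> \<subseteq> S"
    proof
      fix s assume "s \<in> range \<tau>"
      then obtain i where "s = \<tau> i" by blast
      then show "s \<in> S"
        using \<sigma>(2) \<rho>(2) rangeI[of \<sigma> "nat i"] rangeI[of \<rho> "nat (- i - 1)"]
        by (cases "i \<ge> 0") (auto simp: \<tau>_def)
    qed
    show "S \<subseteq> range \<tau>"
    proof
      fix s assume s: "s \<in> S"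
      show "s \<in> range \<tau>"
      proof (cases "s \<ge> 0")
        case True
        then have "s \<in> range \<sigma>" using s \<sigma>(2) by simp
        then show ?thesis using \<tau>_int by (metis imageE rangeI)
      next
        case False
        then have "- s \<in> range \<rho>" using s \<rho>(2) by simp
        then show ?thesis using \<tau>_neg by (metis imageE rangeI minus_minus)
      qed
    qed
  qed
  moreover have "\<tau> (-1) < 0" "0 \<le> \<tau> 0"
    using \<rho>_pos[of 0] \<sigma>_ge[of 0] by (auto simp: \<tau>_def)
  moreover have "f = g"
    if f: "strict_mono f" "range f = S" "f (-1) < 0" "0 \<le> f 0"
      and g: "strict_mono g" "range g = S" "g (-1) < 0" "0 \<le> g 0" for f g :: "int \<Rightarrow> real"
  proof -
    define \<pi> where "\<pi> i = inv g (f i)" for i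
    have \<pi>: "g (\<pi> i) = f i" for i
      unfolding \<pi>_def by (rule f_inv_into_f) (use f(2) g(2) in blast)
    have mono: "\<pi> i < \<pi> j \<longleftrightarrow> i < j" for i j
      using strict_mono_less[OF f(1), of i j] strict_mono_less[OF g(1), of "\<pi> i" "\<pi> j"] by (simp add: \<pi>)
    have surj: "\<exists>i. \<pi> i = j" for j
    proof -
      obtain i where "f i = g j"
        using f(2) g(2) by (metis imageE rangeI)
      then have "g (\<pi> i) = g j" by (simp add: \<pi>)
      then show ?thesis using strict_mono_eq[OF g(1)] by auto
    qed
    have step: "\<pi> (i + 1) = \<pi> i + 1" for i
    proof -
      obtain j where j: "\<pi> j = \<pi> i + 1"
        using surj by blast
      then have "i < j"
        using mono[of i j] by simp
      moreover have "\<not> i + 1 < j"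
        using j mono[of i "i + 1"] mono[of "i + 1" j] by auto
      ultimately show ?thesis
        using j by (metis add1_zle_eq order_le_less)
    qed
    \<comment> \<open>The two normalisations are played against each other:
      \<open>\<pi> 0 > -1\<close>, and \<open>\<pi> (-1) < 0\<close> gives
      \<open>\<pi> 0 \<le> 0\<close> by one step.\<close>
    have "g (-1) < g (\<pi> 0)" "g (\<pi> (-1)) < g 0"
      using f(3,4) g(3,4) by (simp_all add: \<pi>)
    then have "\<pi> 0 > -1" "\<pi> (-1) < 0"
      by (simp_all add: strict_mono_less[OF g(1)])
    then have "\<pi> 0 = 0"
      using step[of "-1"] by simp
    have "\<pi> i = i" for i
    proof (induction i rule: int_induct[where k = 0])
      case base
      then show ?case by fact
    next
      case (step1 i)
      then show ?case using step by simp
    next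
      case (step2 i)
      then show ?case using step[of "i - 1"] by simp
    qed
    then show ?thesis
      using \<pi> by (metis ext)
  qed
  ultimately show ?thesis
    by (intro ex1I[of _ \<tau>]) blast+
qed

section \<open>Jumps before a fixed time\<close>

definition distinct_jumps :: "nat \<Rightarrow> (nat \<Rightarrow> int \<Rightarrow> real) set" where
  "distinct_jumps n = {\<omega>. \<forall>k\<in>{0..n}. \<forall>k'\<in>{0..n}. \<forall>j j'. k \<noteq> k' \<longrightarrow> jump_time \<omega> k j \<noteq> jump_time \<omega> k' j'}"

text \<open>Arrival numbers are recorded along with the clocks, so that for a fixed word the
  condition compares individual jump times and contains no definite description. Equality of sets
  makes the list complete; the half-open window is that of \<open>cocycle\<close>.\<close>

definition jump_word :: "nat \<Rightarrow> real \<Rightarrow> (nat \<Rightarrow> int \<Rightarrow> real) \<Rightarrow> (nat \<times> int) list \<Rightarrow> bool" where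
  "jump_word n t \<omega> ps \<longleftrightarrow>
     sorted_wrt (<) (map (\<lambda>(k, j). jump_time \<omega> k j) ps) \<and>
     set ps = {(k, j). k \<le> n \<and> 0 \<le> jump_time \<omega> k j \<and> jump_time \<omega> k j < t}"

context
  fixes n :: nat and \<omega> :: "nat \<Rightarrow> int \<Rightarrow> real"
  assumes paths: "\<And>k. k \<le> n \<Longrightarrow> \<omega> k \<in> clock_paths"
    and distinct_jumps: "\<omega> \<in> distinct_jumps n"
begin

lemma finite_jumps_between: "finite {(k, j). k \<le> n \<and> jump_time \<omega> k j \<in> {a..b}}"
proof -
  have "{(k, j). k \<le> n \<and> jump_time \<omega> k j \<in> {a..b}} = (SIGMA k:{..n}. {j. jump_time \<omega> k j \<in> {a..b}})"
    by auto
  also have "finite \<dots>"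
    using paths finite_arrivals_between by (intro finite_SigmaI) (auto simp: jump_time_def)
  finally show ?thesis .
qed

lemma jump_index_unique:
  assumes "k \<le> n" "k' \<le> n" "jump_time \<omega> k j = jump_time \<omega> k' j'"
  shows "k = k'"
  using distinct_jumps assms by (force simp: distinct_jumps_def)

text \<open>The description denotes: finitely many locally finite clocks are jointly locally finite,
  and clock 0 alone already has jumps arbitrarily far out in both directions.\<close>

lemma ordered_times:
  "strict_mono (ordered_times n \<omega>)"
  "range (ordered_times n \<omega>) = {jump_time \<omega> k j | k j. k \<in> {0..n}}"
  "ordered_times n \<omega> (-1) < 0" "0 \<le> ordered_times n \<omega> 0"
proof -
  let ?S = "{jump_time \<omega> k j | k j. k \<in> {0..n}}"
  have "\<exists>!\<tau>::int \<Rightarrow> real. strict_mono \<tau> \<and> range \<tau> = ?S \<and> \<tau> (-1) < 0 \<and> 0 \<le> \<tau> 0"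
  proof (rule ex1_int_enumeration)
    show "finite (?S \<inter> {a..b})" for a b
    proof -
      have "?S \<inter> {a..b} \<subseteq> (\<lambda>(k, j). jump_time \<omega> k j) ` {(k, j). k \<le> n \<and> jump_time \<omega> k j \<in> {a..b}}"
        by auto
      then show ?thesis
        by (rule finite_subset) (rule finite_imageI[OF finite_jumps_between])
    qed
    show "\<exists>s\<in>?S. c < s" "\<exists>s\<in>?S. s < c" for c
    proof -
      have 0: "\<omega> 0 \<in> clock_paths"
        using paths by simp
      obtain l1 l2 where "c < jump_time \<omega> 0 l1" "jump_time \<omega> 0 l2 < c"
        using arrivals_unbounded_above[OF 0] arrivals_unbounded_below[OF 0] by (metis jump_time_def)
      moreover have "jump_time \<omega> 0 l \<in> ?S" for l
        by auto
      ultimately show "\<exists>s\<in>?S. c < s" "\<exists>s\<in>?S. s < c"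
        by blast+
    qed
  qed
  from theI'[OF this]
  show "strict_mono (ordered_times n \<omega>)"
    "range (ordered_times n \<omega>) = ?S"
    "ordered_times n \<omega> (-1) < 0" "0 \<le> ordered_times n \<omega> 0"
    unfolding ordered_times_def by blast+
qed

lemma jump_index_eq:
  assumes "k \<le> n" "ordered_times n \<omega> i = jump_time \<omega> k j"
  shows "jump_index n \<omega> i = k"
  unfolding jump_index_def
proof (rule the_equality)
  fix k'
  assume *: "k' \<in> {0..n} \<and> (\<exists>j. ordered_times n \<omega> i = jump_time \<omega> k' j)"
  then obtain j' where "ordered_times n \<omega> i = jump_time \<omega> k' j'"
    by blast
  then show "k' = k"
    using * assms jump_index_unique[of k' k j' j] by simp
qed (use assms in auto)

text \<open>The finitely many times in the window are sorted and pulled back to pairs. The pullback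
  is faithful because different clocks share no jump time and each single clock is strictly
  increasing.\<close>

lemma jump_word_exists: "\<exists>ps. jump_word n t \<omega> ps"
proof -
  let ?F = "{(k, j). k \<le> n \<and> 0 \<le> jump_time \<omega> k j \<and> jump_time \<omega> k j < t}"
  let ?T = "\<lambda>(k, j). jump_time \<omega> k j"
  have "?F \<subseteq> {(k, j). k \<le> n \<and> jump_time \<omega> k j \<in> {0..t}}"
    by auto
  then have fin: "finite ?F"
    by (rule finite_subset) (rule finite_jumps_between)
  have inj: "inj_on ?T ?F"
  proof (rule inj_onI, clarify)
    fix k j k' j'
    assume *: "k \<le> n" "k' \<le> n" "jump_time \<omega> k j = jump_time \<omega> k' j'"
    then have "k = k'"
      by (rule jump_index_unique)
    with * show "k = k' \<and> j = j'"
      using strict_mono_eq[OF strict_mono_arrivals[OF paths[of k]]] by (simp add: jump_time_def)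
  qed
  define ps where "ps = map (inv_into ?F ?T) (sorted_list_of_set (?T ` ?F))"
  have "map ?T ps = sorted_list_of_set (?T ` ?F)"
    unfolding ps_def map_map
    by (rule map_idI) (simp only: o_apply set_sorted_list_of_set[OF finite_imageI[OF fin]] f_inv_into_f)
  then have "sorted_wrt (<) (map ?T ps)"
    by (simp only: strict_sorted_list_of_set)
  moreover have "set ps = ?F"
    unfolding ps_def set_map set_sorted_list_of_set[OF finite_imageI[OF fin]]
    by (rule inv_into_image_cancel[OF inj order_refl])
  ultimately have "jump_word n t \<omega> ps"
    unfolding jump_word_def ..
  then show ?thesis ..
qed

text \<open>The times enumerated by \<open>ordered_times\<close> within the window and the times
  along \<open>ps\<close> form two strictly increasing lists with the same elements. They agree
  entry by entry, and the clock of each jump is determined by its time.\<close>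

lemma cocycle_jump_word:
  assumes "jump_word n t \<omega> ps"
  shows "cocycle n t x \<omega> = fold (\<lambda>k x. hop n x k) (map fst ps) x"
proof -
  let ?\<tau> = "ordered_times n \<omega>"
  let ?T = "\<lambda>(k, j). jump_time \<omega> k j"
  let ?I = "{i. ?\<tau> i \<in> {0..<t}}"
  note mono = ordered_times(1)
  have set_ps: "set ps = {(k, j). k \<le> n \<and> 0 \<le> jump_time \<omega> k j \<and> jump_time \<omega> k j < t}"
    and sorted: "sorted_wrt (<) (map ?T ps)"
    using assms by (auto simp: jump_word_def)
  have nonneg: "0 \<le> ?\<tau> i \<longleftrightarrow> 0 \<le> i" for i
  proof
    assume "0 \<le> ?\<tau> i"
    then have "?\<tau> (-1) < ?\<tau> i"
      using ordered_times(3) by linarith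
    then show "0 \<le> i"
      by (simp add: strict_mono_less[OF mono])
  next
    assume "0 \<le> i"
    then show "0 \<le> ?\<tau> i"
      using ordered_times(4) strict_mono_less_eq[OF mono, of 0 i] by simp
  qed
  have images: "?\<tau> ` ?I = set (map ?T ps)"
  proof -
    have "?\<tau> ` ?I = range ?\<tau> \<inter> {0..<t}"
      by auto
    also have "\<dots> = set (map ?T ps)"
      unfolding ordered_times(2) by (auto simp: set_ps image_iff)
    finally show ?thesis .
  qed
  then have "finite (?\<tau> ` ?I)"
    by simp
  then have fin: "finite ?I"
    by (rule finite_imageD) (rule inj_on_subset[OF strict_mono_imp_inj_on[OF mono] subset_UNIV])
  have "\<exists>N. \<not> ?\<tau> (int N) < t"
  proof (rule ccontr)
    assume "\<not> ?thesis"
    then have "range int \<subseteq> ?I"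
      using nonneg by auto
    then have "finite (range int)"
      by (rule finite_subset) (rule fin)
    then show False
      by (meson finite_imageD infinite_UNIV_nat inj_on_of_nat)
  qed
  \<comment> \<open>\<open>N\<close> is the least index whose time lies outside the window, hence
    the number of jumps in it.\<close>
  then obtain N where N: "\<not> ?\<tau> (int N) < t" "\<And>m. m < N \<Longrightarrow> ?\<tau> (int m) < t"
    using exists_least_iff[of "\<lambda>N. \<not> ?\<tau> (int N) < t"] by auto
  have I: "?I = int ` {..<N}"
  proof
    show "?I \<subseteq> int ` {..<N}"
    proof
      fix i assume "i \<in> ?I"
      then have "0 \<le> i" "?\<tau> i < ?\<tau> (int N)"
        using nonneg N(1) by auto
      then show "i \<in> int ` {..<N}"
        by (intro image_eqI[of _ _ "nat i"]) (auto simp: strict_mono_less[OF mono])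
    qed
    show "int ` {..<N} \<subseteq> ?I"
      using N(2) nonneg by auto
  qed
  have lists: "map (\<lambda>p. ?\<tau> (int p)) [0..<N] = map ?T ps"
  proof (rule strict_sorted_equal)
    show "sorted_wrt (<) (map (\<lambda>p. ?\<tau> (int p)) [0..<N])"
      by (auto simp: sorted_wrt_map sorted_wrt_iff_nth_less strict_mono_less[OF mono])
    have "set (map (\<lambda>p. ?\<tau> (int p)) [0..<N]) = ?\<tau> ` ?I"
      unfolding I by (simp add: image_image atLeast0LessThan)
    with images show "set (map (\<lambda>p. ?\<tau> (int p)) [0..<N]) = set (map ?T ps)"
      by simp
  qed (fact sorted)
  then have len: "length ps = N"
    by (metis diff_zero length_map length_upt)
  have index: "jump_index n \<omega> (int p) = fst (ps ! p)" if p: "p < N" for p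
  proof -
    have "?\<tau> (int p) = ?T (ps ! p)"
      using arg_cong[OF lists, of "\<lambda>xs. xs ! p"] p len by simp
    moreover have "ps ! p \<in> set ps"
      using p len by simp
    ultimately show ?thesis
      using set_ps by (cases "ps ! p") (auto intro!: jump_index_eq)
  qed
  have steps: "after_jumps n x \<omega> p = fold (\<lambda>k x. hop n x k) (map fst (take p ps)) x" if "p \<le> N" for p
    using that by (induction p) (auto simp: take_Suc_conv_app_nth len index)
  show ?thesis
  proof (cases N)
    case 0
    then show ?thesis
      using I len by (simp add: cocycle_def)
  next
    case (Suc m)
    \<comment> \<open>The cocycle names the last jump m, not their number, hence
      \<open>N = Suc m\<close>. The case without jumps is apart since \<open>{0..int m}\<close> is
      never empty.\<close>
    have I': "?I = {0..int m}"
      unfolding I Suc by (auto simp: image_iff intro!: bexI[of _ "nat _"])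
    have "(THE m. ?I = {0..int m}) = m"
      unfolding I' by (rule the_equality) (auto simp: atLeastatMost_empty_iff Icc_eq_Icc)
    moreover have "?I \<noteq> {}"
      unfolding I' by simp
    ultimately show ?thesis
      using steps[of N] Suc len by (auto simp: cocycle_def Let_def simp del: after_jumps.simps)
  qed
qed

end

section \<open>From the synchronisation event to words of jumps\<close>

lemma space_clock_space: "space (clock_space l) = clock_paths"
  by (simp add: clock_space_def space_restrict_space space_PiM)

lemma space_tasep_space:
  "space (tasep_space n \<alpha> \<beta> h) = (\<Pi>\<^sub>E k\<in>{0..n}. clock_paths) \<inter> distinct_jumps n"
  by (auto simp: tasep_space_def space_restrict_space space_PiM space_clock_space distinct_jumps_def)

lemma tasep_shift_0:
  assumes "\<omega> \<in> (\<Pi>\<^sub>E k\<in>{0..n}. clock_paths)"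
  shows "tasep_shift n 0 \<omega> = \<omega>"
proof
  fix k
  show "tasep_shift n 0 \<omega> k = \<omega> k"
    using assms by (cases "k \<le> n") (auto simp: tasep_shift_def clock_shift_0 PiE_iff extensional_def)
qed

definition synchronising :: "nat \<Rightarrow> nat list \<Rightarrow> bool" where
  "synchronising n ks \<longleftrightarrow> (\<forall>x\<in>states n. \<forall>y\<in>states n.
     fold (\<lambda>k x. hop n x k) ks x = fold (\<lambda>k x. hop n x k) ks y)"

text \<open>Every sample point realises some word, and for each word that it realises the event
  holds exactly if the clocks of the word synchronise. This turns the event into a countable
  union.\<close>

lemma sync_event_eq:
  "sync_event n \<alpha> \<beta> h t 0 =
     (\<Union>ps\<in>{ps. synchronising n (map fst ps)}. {\<omega> \<in> space (tasep_space n \<alpha> \<beta> h). jump_word n t \<omega> ps})"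
    (is "?L = ?R")
proof -
  have "\<omega> \<in> ?L \<longleftrightarrow> \<omega> \<in> ?R" if \<omega>: "\<omega> \<in> space (tasep_space n \<alpha> \<beta> h)" for \<omega>
  proof -
    have paths: "\<omega> k \<in> clock_paths" if "k \<le> n" for k
      using \<omega> that by (auto simp: space_tasep_space)
    have dist: "\<omega> \<in> distinct_jumps n" and shift: "tasep_shift n 0 \<omega> = \<omega>"
      using \<omega> by (auto simp: space_tasep_space tasep_shift_0)
    have L: "\<omega> \<in> ?L \<longleftrightarrow> synchronising n (map fst ps)" if "jump_word n t \<omega> ps" for ps
      using \<omega> shift cocycle_jump_word[OF paths dist that]
      by (simp add: sync_event_def synchronising_def)
    obtain ps where "jump_word n t \<omega> ps"
      using jump_word_exists[OF paths dist] by blast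
    then show ?thesis
      using L \<omega> by blast
  qed
  moreover have "?L \<subseteq> space (tasep_space n \<alpha> \<beta> h)" "?R \<subseteq> space (tasep_space n \<alpha> \<beta> h)"
    by (auto simp: sync_event_def)
  ultimately show ?thesis
    by blast
qed

section \<open>A synchronising sequence of jumps\<close>

text \<open>
  The effect of the clocks \<open>n, n - 1, \<dots>, k\<close> ringing in this order: site \<open>n\<close> is emptied, and then
  every particle in turn finds the site ahead of it vacant.
\<close>

definition push_from :: "nat \<Rightarrow> nat \<Rightarrow> (nat \<Rightarrow> nat) \<Rightarrow> (nat \<Rightarrow> nat)" where
  "push_from n k x = (\<lambda>i. if i < k \<or> i > n then x i else if i = k then 0 else x (i - 1))"

text \<open>Site \<open>Suc k\<close> is vacant at this moment. A particle at site k moves there;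
  without a particle both sites are 0 already. In either case site \<open>Suc k\<close> receives the
  old value of site k.\<close>

lemma hop_push_from:
  assumes "x \<in> states n" "1 \<le> k" "k < n"
  shows "hop n (push_from n (Suc k) x) k = push_from n k x"
proof -
  have "x k \<in> {0, 1}"
    using PiE_mem[OF assms(1)[unfolded states_def], of k] assms(2,3) by simp
  then show ?thesis
    using assms by (auto simp: hop_def push_from_def fun_eq_iff)
qed

lemma fold_hop_sweep:
  assumes "n \<ge> 1" "x \<in> states n" "r < n"
  shows "fold (\<lambda>k x. hop n x k) (map (\<lambda>p. n - p) [0..<Suc r]) x = push_from n (n - r) x"
  using assms(3)
proof (induction r)
  case 0
  have "hop n x n = push_from n n x"
    using assms by (auto simp: hop_def push_from_def fun_eq_iff)
  then show ?case
    by simp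
next
  case (Suc r)
  have "Suc (n - Suc r) = n - r"
    using Suc.prems by simp
  then have "hop n (push_from n (n - r) x) (n - Suc r) = push_from n (n - Suc r) x"
    using hop_push_from[OF assms(2), of "n - Suc r"] Suc.prems by simp
  with Suc show ?case
    by simp
qed

lemma push_from_states:
  assumes "x \<in> states n"
  shows "push_from n 1 x \<in> states n"
  unfolding states_def
proof (rule PiE_I)
  fix i assume i: "i \<in> {1..n}"
  then have "i \<noteq> 1 \<Longrightarrow> x (i - 1) \<in> {0, 1}"
    by (intro PiE_mem[OF assms[unfolded states_def]]) auto
  with i show "push_from n 1 x i \<in> {0, 1}"
    by (simp add: push_from_def)
next
  fix i assume "i \<notin> {1..n}"
  then show "push_from n 1 x i = undefined"
    using PiE_arb[OF assms[unfolded states_def], of i] by (auto simp: push_from_def)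
qed

text \<open>A single ring counter p replaces a concatenation of sweeps, because the same p later
  numbers the time slot of the ring.\<close>

definition sweeps :: "nat \<Rightarrow> nat \<Rightarrow> nat list" where
  "sweeps n m = map (\<lambda>p. n - p mod n) [0..<m * n]"

lemma sweeps_Suc:
  assumes "n \<ge> 1"
  shows "sweeps n (Suc m) = sweeps n m @ map (\<lambda>p. n - p) [0..<n]"
proof -
  have "[0..<Suc m * n] = [0..<m * n] @ map (\<lambda>p. p + m * n) [0..<n]"
    by (metis add.commute add_0 le0 map_add_upt mult_Suc upt_add_eq_append)
  then show ?thesis
    by (simp add: sweeps_def)
qed

text \<open>A full sweep is a shift to the right that feeds in a 0 at site 1, so each sweep
  lengthens the initial block of vacancies by one.\<close>

lemma fold_hop_sweeps:
  assumes "n \<ge> 1" "x \<in> states n"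
  shows "fold (\<lambda>k x. hop n x k) (sweeps n m) x \<in> states n \<and>
    (\<forall>i\<in>{1..min m n}. fold (\<lambda>k x. hop n x k) (sweeps n m) x i = 0)"
proof (induction m)
  case 0
  then show ?case
    using assms by (simp add: sweeps_def)
next
  case (Suc m)
  let ?y = "fold (\<lambda>k x. hop n x k) (sweeps n m) x"
  have "fold (\<lambda>k x. hop n x k) (sweeps n (Suc m)) x = push_from n 1 ?y"
    using fold_hop_sweep[of n ?y "n - 1"] Suc assms(1) by (simp add: sweeps_Suc)
  moreover have "push_from n 1 ?y i = 0" if "i \<in> {1..min (Suc m) n}" for i
  proof (cases "i = 1")
    case False
    with that have "i - 1 \<in> {1..min m n}"
      by auto
    with that Suc False show ?thesis
      by (simp add: push_from_def)
  qed (use assms in \<open>simp add: push_from_def\<close>)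
  ultimately show ?case
    using Suc push_from_states[of ?y] by simp
qed

lemma synchronising_sweeps:
  assumes "n \<ge> 1"
  shows "synchronising n (sweeps n n)"
  unfolding synchronising_def
proof (intro ballI ext)
  fix x y i
  assume x: "x \<in> states n" and y: "y \<in> states n"
  \<comment> \<open>Off the sites the common value is \<open>undefined\<close> by extensionality, so
    the configurations agree as functions.\<close>
  have "fold (\<lambda>k x. hop n x k) (sweeps n n) z i = (if i \<in> {1..n} then 0 else undefined)"
    if "z \<in> states n" for z
  proof (cases "i \<in> {1..n}")
    case True
    then show ?thesis
      using fold_hop_sweeps[OF assms that, of n] by simp
  next
    case False
    then show ?thesis
      using fold_hop_sweeps[OF assms that, of n] PiE_arb[of _ "{1..n}" "\<lambda>_. {0, 1}" i]
      unfolding states_def by auto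
  qed
  from this[OF x] this[OF y]
  show "fold (\<lambda>k x. hop n x k) (sweeps n n) x i = fold (\<lambda>k x. hop n x k) (sweeps n n) y i"
    by (rule trans[OF _ sym])
qed

section \<open>Waiting times that realise the sweeps\<close>

definition sweep_jumps :: "nat \<Rightarrow> (nat \<times> int) list" where
  "sweep_jumps n = map (\<lambda>p. (n - p mod n, int (p div n))) [0..<n * n]"

lemma map_fst_sweep_jumps: "map fst (sweep_jumps n) = sweeps n n"
  by (simp add: sweep_jumps_def sweeps_def)

text \<open>Ring p falls into slot p, and the slots are disjoint and ordered, which gives the order
  of the jumps. Each clock from 1 to n rings once per sweep, so ring p is arrival
  \<open>p div n\<close> of its clock. Completeness holds because clock 0 is silent, arrivals of
  negative index precede the origin, and those from index n on come too late.\<close>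

lemma jump_word_sweep_jumps:
  assumes n: "n \<ge> 1" and d: "d > 0"
    and paths: "\<And>k. k \<le> n \<Longrightarrow> \<omega> k \<in> clock_paths"
    and idle: "real (n * n) * d \<le> jump_time \<omega> 0 0"
    and window: "\<And>k m. k \<in> {1..n} \<Longrightarrow> m < n \<Longrightarrow>
      jump_time \<omega> k (int m) \<in> {real (m * n + (n - k)) * d<..<real (m * n + (n - k) + 1) * d}"
    and last: "\<And>k. k \<in> {1..n} \<Longrightarrow> real (n * n) * d \<le> jump_time \<omega> k (int n)"
  shows "jump_word n (real (n * n) * d) \<omega> (sweep_jumps n)"
proof -
  let ?T = "\<lambda>p. jump_time \<omega> (n - p mod n) (int (p div n))"
  have win: "?T p \<in> {real p * d<..<real (p + 1) * d}" if "p < n * n" for p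
  proof -
    have mod: "p mod n < n"
      using n by simp
    have "p div n < n"
      using that by (simp add: less_mult_imp_div_less)
    moreover have "n - p mod n \<in> {1..n}"
      using mod by auto
    moreover have "p div n * n + (n - (n - p mod n)) = p"
      using mod by simp
    ultimately show ?thesis
      using window[of "n - p mod n" "p div n"] by (simp only:)
  qed
  have mono: "jump_time \<omega> k i < jump_time \<omega> k j \<longleftrightarrow> i < j" if "k \<le> n" for k i j
    using strict_mono_less[OF strict_mono_arrivals[OF paths[OF that]]] by (simp add: jump_time_def)
  have neg: "jump_time \<omega> k j < 0 \<longleftrightarrow> j < 0" if "k \<le> n" for k j
    using arrivals_at_origin[OF paths[OF that]] mono[OF that, of j "-1"] mono[OF that, of "-1" j] mono[OF that, of j 0]
    by (smt (verit) jump_time_def)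
  show ?thesis
    unfolding jump_word_def
  proof
    show "sorted_wrt (<) (map (\<lambda>(k, j). jump_time \<omega> k j) (sweep_jumps n))"
      unfolding sweep_jumps_def sorted_wrt_map
    proof (rule sorted_wrt_mono_rel[of _ "(<)"])
      fix p q assume "p \<in> set [0..<n * n]" "q \<in> set [0..<n * n]" "p < q"
      moreover from this have "real (p + 1) * d \<le> real q * d"
        using d by (intro mult_right_mono) auto
      ultimately show "(case (n - p mod n, int (p div n)) of (k, j) \<Rightarrow> jump_time \<omega> k j)
          < (case (n - q mod n, int (q div n)) of (k, j) \<Rightarrow> jump_time \<omega> k j)"
        using win[of p] win[of q] by simp
    qed (rule sorted_wrt_upt)
    show "set (sweep_jumps n) =
        {(k, j). k \<le> n \<and> 0 \<le> jump_time \<omega> k j \<and> jump_time \<omega> k j < real (n * n) * d}"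
    proof (intro set_eqI iffI)
      fix z assume "z \<in> set (sweep_jumps n)"
      then obtain p where p: "p < n * n" "z = (n - p mod n, int (p div n))"
        by (auto simp: sweep_jumps_def)
      have "0 \<le> real p * d" "real (p + 1) * d \<le> real (n * n) * d"
        using p(1) d by (auto intro!: mult_right_mono simp del: of_nat_mult of_nat_add)
      then show "z \<in> {(k, j). k \<le> n \<and> 0 \<le> jump_time \<omega> k j \<and> jump_time \<omega> k j < real (n * n) * d}"
        using win[OF p(1)] by (auto simp: p(2))
    next
      fix z assume "z \<in> {(k, j). k \<le> n \<and> 0 \<le> jump_time \<omega> k j \<and> jump_time \<omega> k j < real (n * n) * d}"
      then obtain k j where z: "z = (k, j)" "k \<le> n" "0 \<le> jump_time \<omega> k j" "jump_time \<omega> k j < real (n * n) * d"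
        by blast
      have "j \<ge> 0"
        using neg[OF z(2), of j] z(3) by simp
      then obtain m where m: "j = int m"
        using nonneg_int_cases by blast
      have "k \<noteq> 0"
      proof
        assume "k = 0"
        then have "jump_time \<omega> 0 j < jump_time \<omega> 0 0"
          using less_le_trans[OF z(4) idle] by simp
        then show False
          using mono[of 0 j 0] \<open>j \<ge> 0\<close> by simp
      qed
      then have k: "k \<in> {1..n}"
        using z(2) by simp
      have "m < n"
        using mono[OF z(2), of j "int n"] last[OF k] z(4) m by simp
      have "n - k < n"
        using k n by auto
      \<comment> \<open>Within each sweep clock k rings at place \<open>n - k\<close>, so
        \<open>m * n + (n - k)\<close> is the number of the ring that is its arrival m.\<close>
      have "m * n + (n - k) < Suc m * n"
        using \<open>n - k < n\<close> by simp
      also have "\<dots> \<le> n * n"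
        using \<open>m < n\<close> by (intro mult_right_mono) auto
      finally have "m * n + (n - k) \<in> set [0..<n * n]"
        by simp
      moreover have "z = (n - (m * n + (n - k)) mod n, int ((m * n + (n - k)) div n))"
      proof -
        have "(m * n + r) mod n = r" "(m * n + r) div n = m" if "r < n" for r
          using that by auto
        from this[OF \<open>n - k < n\<close>] show ?thesis
          using k by (simp only: z(1) m) simp
      qed
      ultimately show "z \<in> set (sweep_jumps n)"
        unfolding sweep_jumps_def set_map by (rule image_eqI[rotated])
    qed
  qed
qed

text \<open>
  Every sweep lasts \<open>n * d\<close>; the \<open>m + 1\<close> waiting times up to arrival \<open>m < n\<close> of a clock may each
  exceed their nominal values by \<open>d / n\<close> without the arrival leaving its window of length \<open>d\<close>.
\<close>
definition sweep_box :: "nat \<Rightarrow> real \<Rightarrow> nat \<Rightarrow> int \<Rightarrow> real set" where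
  "sweep_box n d k i =
     (if k = 0 \<or> i = int n then {real (n * n) * d<..<real (n * n) * d + 1}
      else if i = 0 then {real (n - k) * d<..<real (n - k) * d + d / real n}
      else {real n * d<..<real n * d + d / real n})"

lemma jump_time_in_window:
  assumes "n \<ge> 1" "d > 0" "k \<in> {1..n}" "m < n"
    and box: "\<And>i. i \<in> {0..int n} \<Longrightarrow> \<omega> k i \<in> sweep_box n d k i"
  shows "jump_time \<omega> k (int m) \<in> {real (m * n + (n - k)) * d<..<real (m * n + (n - k) + 1) * d}"
proof -
  \<comment> \<open>The induction carries the sharper bound: knowing only that arrival m lies in its
    window of length d would leave no room for the tolerance of the next waiting time.\<close>
  have "jump_time \<omega> k (int m) \<in> {real (m * n + (n - k)) * d<..<real (m * n + (n - k)) * d + real (m + 1) * (d / real n)}"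
    using assms(4)
  proof (induction m)
    case 0
    then show ?case
      using box[of 0] assms(1,3) by (auto simp: jump_time_def arrivals_0 sweep_box_def)
  next
    case (Suc m)
    have "\<omega> k (int (Suc m)) \<in> {real n * d<..<real n * d + d / real n}"
      using box[of "int (Suc m)"] Suc.prems assms(3) by (auto simp: sweep_box_def)
    moreover have "jump_time \<omega> k (int (Suc m)) = jump_time \<omega> k (int m) + \<omega> k (int (Suc m))"
      using arrivals_step_nonneg[of "int m" "\<omega> k"] by (simp add: jump_time_def add.commute)
    moreover have "jump_time \<omega> k (int m) \<in> {real (m * n + (n - k)) * d<..<
        real (m * n + (n - k)) * d + real (m + 1) * (d / real n)}"
      using Suc by simp
    moreover have "real (Suc m * n + (n - k)) * d = real (m * n + (n - k)) * d + real n * d"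
      by (simp add: distrib_right)
    moreover have "real (Suc m + 1) * (d / real n) = real (m + 1) * (d / real n) + d / real n"
      by (simp add: distrib_right add_divide_distrib)
    ultimately show ?case
      unfolding greaterThanLessThan_iff by linarith
  qed
  moreover have "real (m + 1) * (d / real n) \<le> d"
  proof -
    have "real (m + 1) * (d / real n) \<le> real n * (d / real n)"
      using assms by (intro mult_right_mono) auto
    then show ?thesis
      using assms(1) by simp
  qed
  ultimately show ?thesis
    by (simp add: algebra_simps)
qed

text \<open>Entry 0 of clock 0 exceeds the whole period. For the other clocks waiting time n alone
  exceeds it, on top of a nonnegative arrival \<open>n - 1\<close>.\<close>

lemma jump_word_of_sweep_box:
  assumes n: "n \<ge> 1" and d: "d > 0"
    and paths: "\<And>k. k \<le> n \<Longrightarrow> \<omega> k \<in> clock_paths"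
    and box: "\<And>k i. k \<le> n \<Longrightarrow> i \<in> {0..int n} \<Longrightarrow> \<omega> k i \<in> sweep_box n d k i"
  shows "jump_word n (real (n * n) * d) \<omega> (sweep_jumps n)"
proof (rule jump_word_sweep_jumps[OF n d paths])
  show "real (n * n) * d \<le> jump_time \<omega> 0 0"
    using box[of 0 0] by (simp add: jump_time_def arrivals_0 sweep_box_def)
  show "jump_time \<omega> k (int m) \<in> {real (m * n + (n - k)) * d<..<real (m * n + (n - k) + 1) * d}"
    if "k \<in> {1..n}" "m < n" for k m
    using box that by (intro jump_time_in_window[OF n d that]) auto
  show "real (n * n) * d \<le> jump_time \<omega> k (int n)" if k: "k \<in> {1..n}" for k
  proof -
    have step: "jump_time \<omega> k (int n) = jump_time \<omega> k (int (n - 1)) + \<omega> k (int n)"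
      using arrivals_step_nonneg[of "int (n - 1)" "\<omega> k"] n by (simp add: jump_time_def)
    have "0 \<le> real ((n - 1) * n + (n - k)) * d"
      using d by simp
    also have "\<dots> < jump_time \<omega> k (int (n - 1))"
    proof -
      have "\<omega> k i \<in> sweep_box n d k i" if "i \<in> {0..int n}" for i
        using box k that by simp
      then show ?thesis
        using jump_time_in_window[OF n d k, of "n - 1" \<omega>] n unfolding greaterThanLessThan_iff by simp
    qed
    finally show ?thesis
      using box[of k "int n"] k by (simp add: step sweep_box_def)
  qed
qed

text \<open>This is the shape for which the exponential law gives positive mass. Left end 0 occurs,
  for the first ring of clock n.\<close>

lemma sweep_box_interval:
  assumes "n \<ge> 1" "d > 0"
  shows "\<exists>a b. 0 \<le> a \<and> a < b \<and> sweep_box n d k i = {a<..<b}"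
proof -
  have "\<exists>a' b'. 0 \<le> a' \<and> a' < b' \<and> {a<..<b} = {a'<..<b'}" if "0 \<le> a" "a < b" for a b :: real
    using that by blast
  moreover have "0 < d / real n"
    using assms by simp
  ultimately show ?thesis
    unfolding sweep_box_def using assms(2) by (simp only: split: if_split) simp
qed

section \<open>Waiting times of one clock\<close>

text \<open>Fubini after splitting off coordinate i. It serves twice: with waiting times as
  coordinates, to show that arrivals have no atoms, and with whole clocks as coordinates, to exclude
  coincidences.\<close>

lemma emeasure_PiM_eq_0_slice:
  assumes M: "\<And>i. i \<in> I \<Longrightarrow> prob_space (M i)" and i: "i \<in> I"
    and A: "A \<in> sets (PiM I M)"
    and slice: "\<And>\<omega>. \<omega> \<in> space (PiM (I - {i}) M) \<Longrightarrow> emeasure (M i) {x \<in> space (M i). fun_upd \<omega> i x \<in> A} = 0"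
  shows "emeasure (PiM I M) A = 0"
proof -
  let ?J = "I - {i}"
  let ?N = "PiM ?J M"
  let ?f = "\<lambda>(x, X). X(i := x)"
  have I: "insert i ?J = I"
    using i by auto
  interpret Mi: prob_space "M i"
    using M i by auto
  interpret N: prob_space ?N
    using M by (intro prob_space_PiM) auto
  interpret pair_sigma_finite "M i" ?N ..
  have f: "?f \<in> measurable (M i \<Otimes>\<^sub>M ?N) (PiM I M)"
    using measurable_compose[OF measurable_pair_swap' measurable_add_dim[of i ?J M]] unfolding I by (simp add: case_prod_unfold)
  have eq: "distr (M i \<Otimes>\<^sub>M ?N) (PiM I M) ?f = PiM I M"
    using distr_pair_PiM_eq_PiM[of ?J M i] M i unfolding I by auto
  let ?B = "?f -` A \<inter> space (M i \<Otimes>\<^sub>M ?N)"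
  have B: "?B \<in> sets (M i \<Otimes>\<^sub>M ?N)"
    using f A by (rule measurable_sets)
  have "emeasure (PiM I M) A = emeasure (M i \<Otimes>\<^sub>M ?N) ?B"
    by (subst eq[symmetric]) (rule emeasure_distr[OF f A])
  also have "\<dots> = (\<integral>\<^sup>+ \<omega>. emeasure (M i) ((\<lambda>x. (x, \<omega>)) -` ?B) \<partial>?N)"
    by (rule emeasure_pair_measure_alt2[OF B])
  also have "\<dots> = (\<integral>\<^sup>+ \<omega>. 0 \<partial>?N)"
  proof (rule nn_integral_cong)
    fix \<omega> assume "\<omega> \<in> space ?N"
    then have "(\<lambda>x. (x, \<omega>)) -` ?B = {x \<in> space (M i). fun_upd \<omega> i x \<in> A}"
      by (auto simp: space_pair_measure)
    with slice[OF \<open>\<omega> \<in> space ?N\<close>] show "emeasure (M i) ((\<lambda>x. (x, \<omega>)) -` ?B) = 0"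
      by simp
  qed
  finally show ?thesis
    by simp
qed

section \<open>The exponential distribution\<close>

definition exp_dist :: "real \<Rightarrow> real measure" where
  "exp_dist l = density lborel (\<lambda>x. ennreal (exponential_density l x))"

lemma sets_exp_dist [measurable_cong, simp]: "sets (exp_dist l) = sets borel"
  by (simp add: exp_dist_def)

lemma space_exp_dist [simp]: "space (exp_dist l) = UNIV"
  by (simp add: exp_dist_def)

lemma prob_space_exp_dist: "l > 0 \<Longrightarrow> prob_space (exp_dist l)"
  unfolding exp_dist_def by (rule prob_space_exponential_density)

lemma emeasure_exp_dist_eq_0_iff:
  assumes "A \<in> sets borel"
  shows "emeasure (exp_dist l) A = 0 \<longleftrightarrow> (AE x in lborel. x \<in> A \<longrightarrow> exponential_density l x \<le> 0)"
proof -
  have "A \<in> null_sets (exp_dist l) \<longleftrightarrow> A \<in> sets lborel \<and> (AE x in lborel. x \<in> A \<longrightarrow> ennreal (exponential_density l x) = 0)"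
    unfolding exp_dist_def by (rule null_sets_density_iff) simp
  then show ?thesis
    using assms by (simp add: null_sets_def ennreal_eq_0_iff)
qed

lemma emeasure_exp_dist_singleton: "emeasure (exp_dist l) {c} = 0"
proof -
  have "AE x in lborel. x \<in> {c} \<longrightarrow> exponential_density l x \<le> 0"
    using AE_lborel_singleton[of c] by eventually_elim simp
  then show ?thesis
    by (simp only: emeasure_exp_dist_eq_0_iff[OF borel_singleton[OF sets.empty_sets]])
qed

text \<open>The density is strictly positive on the interval, so mass 0 would make the interval a
  Lebesgue null set.\<close>

lemma emeasure_exp_dist_interval:
  assumes "l > 0" "0 \<le> a" "a < b"
  shows "emeasure (exp_dist l) {a<..<b} > 0"
proof (rule ccontr)
  assume "\<not> ?thesis"
  then have "AE x in lborel. x \<in> {a<..<b} \<longrightarrow> exponential_density l x \<le> 0"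
    by (simp add: emeasure_exp_dist_eq_0_iff)
  then have "AE x in lborel. x \<notin> {a<..<b}"
    using assms by (auto simp: exponential_density_def mult_le_0_iff not_le)
  then have "{a<..<b} \<in> null_sets lborel"
    by (subst AE_iff_null_sets) auto
  then have "emeasure lborel {a<..<b} = 0"
    by (rule null_setsD1)
  then show False
    using assms by simp
qed

lemma AE_exp_dist_pos: "AE x in exp_dist l. 0 < x"
proof -
  \<comment> \<open>The density at 0 is \<open>l\<close> and need not vanish; the point 0 is
    discarded as a Lebesgue null set.\<close>
  have "emeasure (exp_dist l) {..0} = 0"
    by (subst emeasure_exp_dist_eq_0_iff)
      (use AE_lborel_singleton[of 0] in \<open>auto simp: exponential_density_def elim!: eventually_mono\<close>)
  then show ?thesis
    by (intro AE_I[of _ _ "{..0}"]) (auto simp: not_less)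
qed

context
  fixes l :: real
  assumes l: "l > 0"
begin

abbreviation (input) "waiting_times \<equiv> PiM (UNIV :: int set) (\<lambda>_. exp_dist l)"

lemma prob_space_waiting_times: "prob_space waiting_times"
  using prob_space_exp_dist[OF l] by (intro prob_space_PiM)

lemma measurable_clock_paths: "clock_paths \<in> sets waiting_times"
proof -
  have "{\<xi> \<in> space waiting_times. \<xi> 0 \<ge> 0 \<and> (\<forall>i. i \<noteq> 0 \<longrightarrow> \<xi> i > 0)
     \<and> (\<Sum>i::nat. ennreal (\<xi> (int i))) = \<infinity>
     \<and> (\<Sum>i::nat. ennreal (\<xi> (- int (Suc i)))) = \<infinity>} \<in> sets waiting_times"
    by measurable
  then show ?thesis
    by (simp add: clock_paths_def space_PiM)
qed

text \<open>A convergent series has terms below 1 from some m on. This has probability 0, since by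
  independence N chosen terms are all below 1 with probability \<open>q ^ N\<close>, where q < 1.
  The injection \<open>e\<close> covers the forward and the backward half of the line at
  once.\<close>

lemma AE_waiting_times_diverge:
  fixes e :: "nat \<Rightarrow> int"
  assumes e: "inj e"
  shows "AE \<xi> in waiting_times. (\<Sum>i. ennreal (\<xi> (e i))) = \<infinity>"
proof -
  interpret W: prob_space waiting_times
    by (rule prob_space_waiting_times)
  interpret E: prob_space "exp_dist l"
    by (rule prob_space_exp_dist[OF l])
  define q where "q = E.prob {..<1}"
  have "E.prob {1<..<2} > 0"
    using emeasure_exp_dist_interval[OF l, of 1 2] by (simp add: E.emeasure_eq_measure)
  moreover have "q + E.prob {1<..<2} = E.prob ({..<1} \<union> {1<..<2})"
    unfolding q_def by (rule E.finite_measure_Union[symmetric]) auto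
  ultimately have q: "0 \<le> q" "q < 1"
    using E.prob_le_1[of "{..<1} \<union> {1<..<2}"] by (auto simp: q_def simp del: E.prob_le_1)
  have small: "AE \<xi> in waiting_times. \<not> (\<forall>i\<ge>m. \<xi> (e i) < 1)" for m
  proof -
    let ?A = "{\<xi> \<in> space waiting_times. \<forall>i\<ge>m. \<xi> (e i) < 1}"
    have A: "?A \<in> sets waiting_times"
      by measurable
    have "W.prob ?A \<le> q ^ N" for N
    proof -
      let ?J = "e ` {m..<m + N}"
      have card: "card ?J = N"
        using e by (simp add: card_image inj_on_subset)
      have "emeasure waiting_times (prod_emb UNIV (\<lambda>_. exp_dist l) ?J (\<Pi>\<^sub>E i\<in>?J. {..<1})) = (\<Prod>i\<in>?J. emeasure (exp_dist l) {..<1})"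
        using prob_space_exp_dist[OF l] by (intro emeasure_PiM_emb) auto
      also have "\<dots> = ennreal (q ^ N)"
        by (simp add: card E.emeasure_eq_measure q_def ennreal_power)
      finally have "emeasure waiting_times (prod_emb UNIV (\<lambda>_. exp_dist l) ?J (\<Pi>\<^sub>E i\<in>?J. {..<1})) = ennreal (q ^ N)" .
      moreover have "emeasure waiting_times ?A \<le> emeasure waiting_times (prod_emb UNIV (\<lambda>_. exp_dist l) ?J (\<Pi>\<^sub>E i\<in>?J. {..<1}))"
        by (intro emeasure_mono sets_PiM_I) (auto simp: prod_emb_def space_PiM)
      ultimately show ?thesis
        using q(1) by (simp add: W.emeasure_eq_measure)
    qed
    moreover have "(\<lambda>N. q ^ N) \<longlonglongrightarrow> 0"
      using q by (intro LIMSEQ_realpow_zero)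
    ultimately have "W.prob ?A \<le> 0"
      by (intro LIMSEQ_le_const) auto
    then have "emeasure waiting_times ?A = 0"
      by (simp add: W.emeasure_eq_measure measure_le_0_iff)
    with A show ?thesis
      by (subst AE_iff_measurable[OF A]) auto
  qed
  have "AE \<xi> in waiting_times. \<forall>i. 0 < \<xi> (e i)"
    unfolding AE_all_countable using prob_space_exp_dist[OF l] AE_exp_dist_pos
    by (auto intro: AE_PiM_component[where P = "\<lambda>x. 0 < x"])
  moreover have "AE \<xi> in waiting_times. \<forall>m. \<not> (\<forall>i\<ge>m. \<xi> (e i) < 1)"
    unfolding AE_all_countable using small by auto
  ultimately show ?thesis
  proof eventually_elim
    case (elim \<xi>)
    show ?case
    proof (rule ccontr)
      assume fin: "\<not> ?thesis"
      have "summable (\<lambda>i. \<xi> (e i))"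
        using fin elim(1) by (intro summable_suminf_not_top) (auto intro: less_imp_le)
      then have "(\<lambda>i. \<xi> (e i)) \<longlonglongrightarrow> 0"
        by (rule summable_LIMSEQ_zero)
      then have "\<forall>\<^sub>F i in sequentially. \<xi> (e i) < 1"
        by (rule order_tendstoD) simp
      then show False
        using elim(2) by (auto simp: eventually_sequentially)
    qed
  qed
qed

lemma AE_clock_paths: "AE \<xi> in waiting_times. \<xi> \<in> clock_paths"
proof -
  have "AE \<xi> in waiting_times. \<forall>i. 0 < \<xi> i"
    unfolding AE_all_countable using prob_space_exp_dist[OF l] AE_exp_dist_pos
    by (auto intro: AE_PiM_component[where P = "\<lambda>x. 0 < x"])
  moreover have "AE \<xi> in waiting_times. (\<Sum>i. ennreal (\<xi> (int i))) = \<infinity>"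
    by (rule AE_waiting_times_diverge) simp
  moreover have "AE \<xi> in waiting_times. (\<Sum>i. ennreal (\<xi> (- int (Suc i)))) = \<infinity>"
    by (rule AE_waiting_times_diverge) (simp add: inj_def)
  ultimately show ?thesis
    by eventually_elim (auto simp: clock_paths_def intro: less_imp_le)
qed

section \<open>The clock space as a restriction to a set of full measure\<close>

lemma clock_space_eq: "clock_space l = restrict_space waiting_times clock_paths"
  by (simp add: clock_space_def exp_dist_def)

lemma sets_clock_space_iff: "A \<in> sets (clock_space l) \<longleftrightarrow> A \<subseteq> clock_paths \<and> A \<in> sets waiting_times"
  using measurable_clock_paths by (auto simp: clock_space_eq sets_restrict_space_iff space_PiM)

lemma emeasure_clock_space:
  assumes "A \<in> sets waiting_times"
  shows "emeasure (clock_space l) (A \<inter> clock_paths) = emeasure waiting_times A"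
proof -
  have "emeasure (clock_space l) (A \<inter> clock_paths) = emeasure waiting_times (A \<inter> clock_paths)"
    unfolding clock_space_eq using measurable_clock_paths by (intro emeasure_restrict_space) auto
  also have "\<dots> = emeasure waiting_times A"
    using AE_clock_paths assms measurable_clock_paths by (intro emeasure_eq_AE) auto
  finally show ?thesis .
qed

lemma prob_space_clock_space: "prob_space (clock_space l)"
proof
  interpret W: prob_space waiting_times
    by (rule prob_space_waiting_times)
  show "emeasure (clock_space l) (space (clock_space l)) = 1"
    using emeasure_clock_space[OF sets.top] W.emeasure_space_1 by (simp add: space_clock_space space_PiM)
qed

lemma measurable_arrivals_waiting_times: "(\<lambda>\<xi>. arrivals \<xi> j) \<in> borel_measurable waiting_times"
  unfolding arrivals_def by measurable

lemma measurable_arrivals: "(\<lambda>\<xi>. arrivals \<xi> j) \<in> borel_measurable (clock_space l)"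
  unfolding clock_space_eq by (rule measurable_restrict_space1) (rule measurable_arrivals_waiting_times)

text \<open>An arrival is affine with slope 1 or -1 in one entry: \<open>\<xi> 0\<close> for
  nonnegative j, \<open>\<xi> (-1)\<close> for negative j. With all other entries fixed, at most one
  value of this entry yields c, and the exponential law has no atoms.\<close>

lemma emeasure_arrivals_eq: "emeasure (clock_space l) {\<xi> \<in> space (clock_space l). arrivals \<xi> j = c} = 0"
proof -
  let ?A = "{\<xi> \<in> space waiting_times. arrivals \<xi> j = c}"
  have A: "?A \<in> sets waiting_times"
    using measurable_arrivals_waiting_times[of j] by measurable
  obtain i b s where s: "\<And>\<xi> x. arrivals (\<xi>(i := x)) j = b \<xi> + s * x" and "s = 1 \<or> s = (-1::real)"
  proof (cases j rule: int_nonneg_neg_cases)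
    case (1 m)
    show ?thesis
    proof (rule that[of 0 "\<lambda>\<xi>. \<Sum>i\<in>{..m} - {0}. \<xi> (int i)" 1])
      fix \<xi> :: "int \<Rightarrow> real" and x
      show "arrivals (\<xi>(0 := x)) j = (\<Sum>i\<in>{..m} - {0}. \<xi> (int i)) + 1 * x"
        unfolding 1 arrivals_int by (subst sum.remove[of _ 0]) (auto intro!: sum.cong)
    qed simp
  next
    case (2 m)
    show ?thesis
    proof (rule that[of "-1" "\<lambda>\<xi>. - (\<Sum>i\<in>{..m} - {0}. \<xi> (- int (Suc i)))" "-1"])
      fix \<xi> :: "int \<Rightarrow> real" and x
      show "arrivals (\<xi>(-1 := x)) j = - (\<Sum>i\<in>{..m} - {0}. \<xi> (- int (Suc i))) + (-1) * x"
        unfolding 2 arrivals_neg by (subst sum.remove[of _ 0]) (auto intro!: sum.cong)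
    qed simp
  qed
  have "emeasure waiting_times ?A = 0"
  proof (rule emeasure_PiM_eq_0_slice[OF prob_space_exp_dist[OF l] _ A])
    fix \<omega>
    \<comment> \<open>Since s is its own inverse, the solution of
      \<open>b \<omega> + s * x = c\<close> is \<open>s * (c - b \<omega>)\<close>.\<close>
    have "{x \<in> space (exp_dist l). fun_upd \<omega> i x \<in> ?A} \<subseteq> {s * (c - b \<omega>)}"
      using \<open>s = 1 \<or> s = -1\<close> by (auto simp: s)
    then have "emeasure (exp_dist l) {x \<in> space (exp_dist l). fun_upd \<omega> i x \<in> ?A} \<le> emeasure (exp_dist l) {s * (c - b \<omega>)}"
      by (rule emeasure_mono) simp
    then show "emeasure (exp_dist l) {x \<in> space (exp_dist l). fun_upd \<omega> i x \<in> ?A} = 0"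
      by (simp add: emeasure_exp_dist_singleton)
  qed simp
  moreover have "{\<xi> \<in> space (clock_space l). arrivals \<xi> j = c} = ?A \<inter> clock_paths"
    by (auto simp: space_clock_space space_PiM)
  ultimately show ?thesis
    using emeasure_clock_space[OF A] by simp
qed

text \<open>By independence the mass is a finite product of positive factors, and the restriction to
  \<open>clock_paths\<close> removes only a null set.\<close>

lemma emeasure_clock_box:
  assumes "finite J" and X: "\<And>i. i \<in> J \<Longrightarrow> \<exists>a b. 0 \<le> a \<and> a < b \<and> X i = {a<..<b}"
  shows "{\<xi> \<in> clock_paths. \<forall>i\<in>J. \<xi> i \<in> X i} \<in> sets (clock_space l)"
    and "emeasure (clock_space l) {\<xi> \<in> clock_paths. \<forall>i\<in>J. \<xi> i \<in> X i} > 0"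
proof -
  let ?B = "prod_emb UNIV (\<lambda>_. exp_dist l) J (\<Pi>\<^sub>E i\<in>J. X i)"
  have X': "X i \<in> sets (exp_dist l)" "emeasure (exp_dist l) (X i) \<noteq> 0" if "i \<in> J" for i
    using X[OF that] emeasure_exp_dist_interval[OF l] by (force simp: zero_less_iff_neq_zero)+
  have eq: "{\<xi> \<in> clock_paths. \<forall>i\<in>J. \<xi> i \<in> X i} = ?B \<inter> clock_paths"
    by (auto simp: prod_emb_def space_PiM PiE_iff)
  have B: "?B \<in> sets waiting_times"
    using assms(1) X' by (intro sets_PiM_I) auto
  then show "{\<xi> \<in> clock_paths. \<forall>i\<in>J. \<xi> i \<in> X i} \<in> sets (clock_space l)"
    unfolding eq sets_clock_space_iff using measurable_clock_paths by auto
  have "emeasure waiting_times ?B = (\<Prod>i\<in>J. emeasure (exp_dist l) (X i))"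
    using prob_space_exp_dist[OF l] assms(1) X' by (intro emeasure_PiM_emb) auto
  also have "\<dots> \<noteq> 0"
    using X' assms(1) by (simp add: prod_zero_iff)
  finally show "emeasure (clock_space l) {\<xi> \<in> clock_paths. \<forall>i\<in>J. \<xi> i \<in> X i} > 0"
    unfolding eq emeasure_clock_space[OF B] by (simp add: zero_less_iff_neq_zero)
qed

end

section \<open>The product of the clocks\<close>

context
  fixes n :: nat and \<alpha> \<beta> :: real and h :: "nat \<Rightarrow> real"
  assumes n: "n \<ge> 1" and \<alpha>: "\<alpha> > 0" and \<beta>: "\<beta> > 0"
    and h: "\<And>k. k \<in> {1..n - 1} \<Longrightarrow> h k > 0"
begin

abbreviation (input) "clock \<equiv> \<lambda>k. clock_space (rate n \<alpha> \<beta> h k)"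
abbreviation (input) "clocks \<equiv> PiM {0..n} (\<lambda>k. clock_space (rate n \<alpha> \<beta> h k))"

lemma rate_pos: "k \<in> {0..n} \<Longrightarrow> rate n \<alpha> \<beta> h k > 0"
  using \<alpha> \<beta> h[of k] by (auto simp: rate_def)

lemma prob_space_clock: "k \<in> {0..n} \<Longrightarrow> prob_space (clock k)"
  by (rule prob_space_clock_space[OF rate_pos])

lemma prob_space_clocks: "prob_space clocks"
  by (rule prob_space_PiM) (rule prob_space_clock)

lemma measurable_jump_time:
  assumes "k \<in> {0..n}"
  shows "(\<lambda>\<omega>. jump_time \<omega> k j) \<in> borel_measurable clocks"
  unfolding jump_time_def
  by (rule measurable_compose[OF _ measurable_arrivals[OF rate_pos[OF assms]]])
    (rule measurable_component_singleton[OF assms])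

text \<open>Clock k is sliced off. As k and k' differ, the time of clock k' is then a constant, and
  an arrival of clock k hits a constant with probability 0.\<close>

lemma AE_jump_times_distinct:
  assumes k: "k \<in> {0..n}" "k' \<in> {0..n}" "k \<noteq> k'"
  shows "AE \<omega> in clocks. jump_time \<omega> k j \<noteq> jump_time \<omega> k' j'"
proof -
  note [measurable] = measurable_jump_time[OF k(1)] measurable_jump_time[OF k(2)]
  let ?A = "{\<omega> \<in> space clocks. jump_time \<omega> k j = jump_time \<omega> k' j'}"
  have A: "?A \<in> sets clocks"
    by measurable
  have "emeasure clocks ?A = 0"
  proof (rule emeasure_PiM_eq_0_slice[OF prob_space_clock k(1) A])
    fix \<omega>
    let ?C = "{\<xi> \<in> space (clock k). arrivals \<xi> j = arrivals (\<omega> k') j'}"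
    note [measurable] = measurable_arrivals[OF rate_pos[OF k(1)]]
    have "{\<xi> \<in> space (clock k). fun_upd \<omega> k \<xi> \<in> ?A} \<subseteq> ?C"
      using k(3) by (auto simp: jump_time_def)
    moreover have "?C \<in> sets (clock k)"
      by measurable
    ultimately have "emeasure (clock k) {\<xi> \<in> space (clock k). fun_upd \<omega> k \<xi> \<in> ?A} \<le> emeasure (clock k) ?C"
      by (rule emeasure_mono)
    then show "emeasure (clock k) {\<xi> \<in> space (clock k). fun_upd \<omega> k \<xi> \<in> ?A} = 0"
      by (simp add: emeasure_arrivals_eq[OF rate_pos[OF k(1)]])
  qed
  then show ?thesis
    by (subst AE_iff_measurable[OF A]) auto
qed

lemma AE_distinct_jumps: "AE \<omega> in clocks. \<omega> \<in> distinct_jumps n"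
proof -
  have "AE \<omega> in clocks. \<forall>k k' j j'. k \<in> {0..n} \<and> k' \<in> {0..n} \<and> k \<noteq> k' \<longrightarrow> jump_time \<omega> k j \<noteq> jump_time \<omega> k' j'"
    unfolding AE_all_countable using AE_jump_times_distinct by (intro allI AE_impI) auto
  then show ?thesis
    by eventually_elim (auto simp: distinct_jumps_def)
qed

lemma measurable_distinct_jumps: "distinct_jumps n \<inter> space clocks \<in> sets clocks"
proof -
  have *: "{\<omega> \<in> space clocks. k \<in> {0..n} \<and> k' \<in> {0..n} \<and> k \<noteq> k' \<longrightarrow> jump_time \<omega> k j \<noteq> jump_time \<omega> k' j'} \<in> sets clocks"
    for k k' j j'
  proof (cases "k \<in> {0..n} \<and> k' \<in> {0..n} \<and> k \<noteq> k'")
    case True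
    then have "{\<omega> \<in> space clocks. jump_time \<omega> k j \<noteq> jump_time \<omega> k' j'} \<in> sets clocks"
      by (intro borel_measurable_neq measurable_jump_time) auto
    with True show ?thesis
      by simp
  qed (simp only: simp_thms Collect_mem_eq sets.top sets.sets_Collect_const)
  have "{\<omega> \<in> space clocks. \<forall>k k' j j'. k \<in> {0..n} \<and> k' \<in> {0..n} \<and> k \<noteq> k' \<longrightarrow> jump_time \<omega> k j \<noteq> jump_time \<omega> k' j'} \<in> sets clocks"
    by (rule sets.sets_Collect_countable_All, rule sets.sets_Collect_countable_All,
        rule sets.sets_Collect_countable_All, rule sets.sets_Collect_countable_All, rule *)
  also have "{\<omega> \<in> space clocks. \<forall>k k' j j'. k \<in> {0..n} \<and> k' \<in> {0..n} \<and> k \<noteq> k' \<longrightarrow> jump_time \<omega> k j \<noteq> jump_time \<omega> k' j'}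
      = distinct_jumps n \<inter> space clocks"
    by (auto simp: distinct_jumps_def)
  finally show ?thesis .
qed

lemma tasep_space_eq: "tasep_space n \<alpha> \<beta> h = restrict_space clocks (distinct_jumps n)"
  by (simp add: tasep_space_def distinct_jumps_def)

lemma emeasure_tasep_space:
  assumes "A \<in> sets clocks"
  shows "A \<inter> distinct_jumps n \<in> sets (tasep_space n \<alpha> \<beta> h)"
    and "emeasure (tasep_space n \<alpha> \<beta> h) (A \<inter> distinct_jumps n) = emeasure clocks A"
proof -
  have "A \<inter> distinct_jumps n = A \<inter> (distinct_jumps n \<inter> space clocks)"
    using sets.sets_into_space[OF assms] by auto
  then have A: "A \<inter> distinct_jumps n \<in> sets clocks"
    using assms measurable_distinct_jumps by auto
  then show "A \<inter> distinct_jumps n \<in> sets (tasep_space n \<alpha> \<beta> h)"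
    unfolding tasep_space_eq by (simp add: sets_restrict_space_iff[OF measurable_distinct_jumps])
  have "emeasure (tasep_space n \<alpha> \<beta> h) (A \<inter> distinct_jumps n) = emeasure clocks (A \<inter> distinct_jumps n)"
    unfolding tasep_space_eq using measurable_distinct_jumps by (intro emeasure_restrict_space) auto
  also have "\<dots> = emeasure clocks A"
    using AE_distinct_jumps A assms by (intro emeasure_eq_AE) auto
  finally show "emeasure (tasep_space n \<alpha> \<beta> h) (A \<inter> distinct_jumps n) = emeasure clocks A" .
qed

text \<open>Equality of sets is unfolded into one membership condition for each of the countably
  many pairs. Words that mention a clock above n are set apart: they are never realised, and
  \<open>measurable_jump_time\<close> speaks only of clocks up to n.\<close>

lemma measurable_jump_word: "{\<omega> \<in> space clocks. jump_word n t \<omega> ps} \<in> sets clocks"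
proof (cases "\<forall>p\<in>set ps. fst p \<le> n")
  case True
  have T: "(\<lambda>\<omega>. jump_time \<omega> (fst (ps ! p)) (snd (ps ! p))) \<in> borel_measurable clocks" if "p < length ps" for p
    using True that by (intro measurable_jump_time) auto
  have sorted: "{\<omega> \<in> space clocks. p < q \<and> q < length ps \<longrightarrow>
      jump_time \<omega> (fst (ps ! p)) (snd (ps ! p)) < jump_time \<omega> (fst (ps ! q)) (snd (ps ! q))} \<in> sets clocks" for p q
  proof (cases "p < q \<and> q < length ps")
    case True
    then have "{\<omega> \<in> space clocks. jump_time \<omega> (fst (ps ! p)) (snd (ps ! p)) < jump_time \<omega> (fst (ps ! q)) (snd (ps ! q))} \<in> sets clocks"
      by (intro borel_measurable_less T) auto
    with True show ?thesis
      by simp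
  qed (simp only: simp_thms Collect_mem_eq sets.top sets.sets_Collect_const)
  have complete: "{\<omega> \<in> space clocks. (k, j) \<in> set ps \<longleftrightarrow> k \<le> n \<and> 0 \<le> jump_time \<omega> k j \<and> jump_time \<omega> k j < t} \<in> sets clocks" for k j
  proof (cases "k \<le> n")
    case True
    have in_window: "{\<omega> \<in> space clocks. 0 \<le> jump_time \<omega> k j \<and> jump_time \<omega> k j < t} \<in> sets clocks"
    proof (rule sets.sets_Collect_conj)
      have T: "(\<lambda>\<omega>. jump_time \<omega> k j) \<in> borel_measurable clocks"
        using True by (intro measurable_jump_time) auto
      show "{\<omega> \<in> space clocks. 0 \<le> jump_time \<omega> k j} \<in> sets clocks"
        by (rule borel_measurable_le[OF borel_measurable_const T])
      show "{\<omega> \<in> space clocks. jump_time \<omega> k j < t} \<in> sets clocks"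
        by (rule borel_measurable_less[OF T borel_measurable_const])
    qed
    with True sets.sets_Collect_neg[OF in_window] show ?thesis
      by (cases "(k, j) \<in> set ps") (simp_all del: de_Morgan_conj)
  qed (simp only: simp_thms Collect_mem_eq sets.top sets.sets_Collect_const)
  have "{\<omega> \<in> space clocks. (\<forall>p q. p < q \<and> q < length ps \<longrightarrow>
      jump_time \<omega> (fst (ps ! p)) (snd (ps ! p)) < jump_time \<omega> (fst (ps ! q)) (snd (ps ! q))) \<and>
      (\<forall>k j. (k, j) \<in> set ps \<longleftrightarrow> k \<le> n \<and> 0 \<le> jump_time \<omega> k j \<and> jump_time \<omega> k j < t)} \<in> sets clocks"
    by (rule sets.sets_Collect_conj; (rule sets.sets_Collect_countable_All)+) (rule complete, rule sorted)
  also have "{\<omega> \<in> space clocks. (\<forall>p q. p < q \<and> q < length ps \<longrightarrow>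
      jump_time \<omega> (fst (ps ! p)) (snd (ps ! p)) < jump_time \<omega> (fst (ps ! q)) (snd (ps ! q))) \<and>
      (\<forall>k j. (k, j) \<in> set ps \<longleftrightarrow> k \<le> n \<and> 0 \<le> jump_time \<omega> k j \<and> jump_time \<omega> k j < t)}
      = {\<omega> \<in> space clocks. jump_word n t \<omega> ps}"
  proof -
    have "jump_word n t \<omega> ps \<longleftrightarrow> (\<forall>p q. p < q \<and> q < length ps \<longrightarrow>
      jump_time \<omega> (fst (ps ! p)) (snd (ps ! p)) < jump_time \<omega> (fst (ps ! q)) (snd (ps ! q))) \<and>
      (\<forall>k j. (k, j) \<in> set ps \<longleftrightarrow> k \<le> n \<and> 0 \<le> jump_time \<omega> k j \<and> jump_time \<omega> k j < t)" for \<omega>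
      unfolding jump_word_def sorted_wrt_map sorted_wrt_iff_nth_less set_eq_iff split_paired_All
        case_prod_unfold mem_Collect_eq fst_conv snd_conv by (simp add: imp_conjL)
    then show ?thesis
      by simp
  qed
  finally show ?thesis .
next
  case False
  then have "\<not> jump_word n t \<omega> ps" for \<omega>
    by (auto simp: jump_word_def)
  then show ?thesis
    by simp
qed

lemma jump_word_event_eq:
  "{\<omega> \<in> space (tasep_space n \<alpha> \<beta> h). jump_word n t \<omega> ps} = {\<omega> \<in> space clocks. jump_word n t \<omega> ps} \<inter> distinct_jumps n"
  unfolding tasep_space_eq space_restrict_space by blast

text \<open>Needed for \<open>emeasure_mono\<close>, which requires the larger set to be
  measurable.\<close>

lemma measurable_sync_event: "sync_event n \<alpha> \<beta> h t 0 \<in> sets (tasep_space n \<alpha> \<beta> h)"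
  unfolding sync_event_eq jump_word_event_eq
proof (rule sets.countable_UN'')
  show "countable {ps :: (nat \<times> int) list. synchronising n (map fst ps)}"
    by (rule countableI_type)
qed (rule emeasure_tasep_space(1)[OF measurable_jump_word])

section \<open>Positive probability of the sweeps\<close>

lemma emeasure_sweep_jumps_pos:
  assumes d: "d > 0"
  shows "emeasure clocks {\<omega> \<in> space clocks. jump_word n (real (n * n) * d) \<omega> (sweep_jumps n)} > 0"
proof -
  define X where "X k = {\<xi> \<in> clock_paths. \<forall>i\<in>{0..int n}. \<xi> i \<in> sweep_box n d k i}" for k
  have X: "X k \<in> sets (clock k)" "emeasure (clock k) (X k) > 0" if "k \<in> {0..n}" for k
    unfolding X_def using emeasure_clock_box[OF rate_pos[OF that], of "{0..int n}" "sweep_box n d k"]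
      sweep_box_interval[OF n d] by auto
  have "0 < (\<Prod>k\<in>{0..n}. emeasure (clock k) (X k))"
    using X(2) by (simp add: zero_less_iff_neq_zero prod_zero_iff)
  also have "\<dots> = emeasure clocks (prod_emb {0..n} clock {0..n} (\<Pi>\<^sub>E k\<in>{0..n}. X k))"
    using prob_space_clock X(1) by (intro emeasure_PiM_emb[symmetric]) auto
  also have "\<dots> \<le> emeasure clocks {\<omega> \<in> space clocks. jump_word n (real (n * n) * d) \<omega> (sweep_jumps n)}"
  proof (rule emeasure_mono[OF _ measurable_jump_word])
    show "prod_emb {0..n} clock {0..n} (\<Pi>\<^sub>E k\<in>{0..n}. X k) \<subseteq> {\<omega> \<in> space clocks. jump_word n (real (n * n) * d) \<omega> (sweep_jumps n)}"
    proof
      fix \<omega> assume "\<omega> \<in> prod_emb {0..n} clock {0..n} (\<Pi>\<^sub>E k\<in>{0..n}. X k)"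
      then have "\<omega> \<in> space clocks" and \<omega>: "\<And>k. k \<le> n \<Longrightarrow> \<omega> k \<in> X k"
        by (auto simp: prod_emb_def space_PiM PiE_iff)
      moreover have "jump_word n (real (n * n) * d) \<omega> (sweep_jumps n)"
        using \<omega> by (intro jump_word_of_sweep_box[OF n d]) (auto simp: X_def)
      ultimately show "\<omega> \<in> {\<omega> \<in> space clocks. jump_word n (real (n * n) * d) \<omega> (sweep_jumps n)}"
        by simp
    qed
  qed
  finally show ?thesis .
qed

lemma measure_sync_event_pos:
  assumes "t > 0"
  shows "measure (tasep_space n \<alpha> \<beta> h) (sync_event n \<alpha> \<beta> h t 0) > 0"
proof -
  let ?P = "tasep_space n \<alpha> \<beta> h"
  define d where "d = t / real (n * n)"
  have d: "d > 0" "t = real (n * n) * d"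
    using assms n by (auto simp: d_def)
  let ?A = "{\<omega> \<in> space clocks. jump_word n t \<omega> (sweep_jumps n)}"
  have "0 < emeasure ?P (?A \<inter> distinct_jumps n)"
    unfolding emeasure_tasep_space(2)[OF measurable_jump_word] unfolding d(2)
    by (rule emeasure_sweep_jumps_pos[OF d(1)])
  also have "\<dots> \<le> emeasure ?P (sync_event n \<alpha> \<beta> h t 0)"
  proof (rule emeasure_mono[OF _ measurable_sync_event])
    show "?A \<inter> distinct_jumps n \<subseteq> sync_event n \<alpha> \<beta> h t 0"
      unfolding sync_event_eq jump_word_event_eq[symmetric]
      using synchronising_sweeps[OF n] by (intro UN_upper) (simp add: map_fst_sweep_jumps)
  qed
  finally have "0 < emeasure ?P (sync_event n \<alpha> \<beta> h t 0)" .
  \<comment> \<open>\<open>measure\<close> is \<open>enn2real\<close> of \<open>emeasure\<close> and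
    would be 0 at infinity, so positivity carries over only together with finiteness.\<close>
  moreover have "emeasure ?P (sync_event n \<alpha> \<beta> h t 0) < \<infinity>"
  proof -
    interpret prob_space clocks
      by (rule prob_space_clocks)
    have "emeasure ?P (space ?P) = emeasure clocks (space clocks)"
      using emeasure_tasep_space(2)[OF sets.top] by (simp add: tasep_space_eq space_restrict_space Int_commute)
    then show ?thesis
      using emeasure_space[of ?P "sync_event n \<alpha> \<beta> h t 0"] emeasure_space_1 by (simp add: le_less_trans)
  qed
  ultimately show ?thesis
    by (simp add: measure_def enn2real_positive_iff)
qed

end

theorem lemma10:
  fixes n :: nat and \<alpha> \<beta> :: real and h :: "nat \<Rightarrow> real"
  assumes "n \<ge> 1"
    and "\<alpha> > 0" and "\<beta> > 0"
    and "\<And>k. k \<in> {1..n - 1} \<Longrightarrow> h k > 0"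
  shows "\<forall>t>0. \<exists>\<delta>>0. measure (tasep_space n \<alpha> \<beta> h) (sync_event n \<alpha> \<beta> h t 0) \<ge> \<delta>"
proof (intro allI impI exI conjI)
  fix t :: real
  assume "t > 0"
  \<comment> \<open>The witness \<delta> is the probability itself; the remaining inequality is
    reflexivity.\<close>
  then show "measure (tasep_space n \<alpha> \<beta> h) (sync_event n \<alpha> \<beta> h t 0) > 0"
    using assms by (intro measure_sync_event_pos)
qed (rule order_refl)

end
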